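(* Let $\rho\in(1,2]$, $\mu,\lambda>0$ and $T>0$. Let $\{\alpha_k\}_{k\ge1}$ be i.i.d. random variables with the Gamma distribution $\Gamma(\mu,\lambda)$ on $(\bar\Omega,\bar{\mathcal F},\bar{\mathbb P})$, and let $W$ be a standard Brownian motion on $(\Omega,\mathcal F,\mathbb P)$. Let $Y_n(t)=\int_0^t \frac1n\sum_{k=1}^n s_{\alpha_k}(t-\tau)\,dW(\tau)$ and $Y(t)=\int_0^t G_\rho^\mu\left(-\frac{(t-\tau)^\rho}{\lambda}\right)dW(\tau)$, regarded as processes with continuous paths on $[0,T]$. Then $$\lim_{n\to\infty}\ \sup_{t\in[0,T]}|Y_n(t)-Y(t)|=0$$ almost surely with respect to $\mathbb P\times\bar{\mathbb P}$.
   Context: The space $(\bar\Omega,\bar{\mathcal F},\bar{\mathbb P})$ carrying the $\alpha_k$ is different from the space $(\Omega,\mathcal F,\mathbb P)$ carrying $W$, and the $\alpha_k$ are independent of $W$; the stochastic integrals are Wiener integrals under $\mathbb P$ with the realization of $(\alpha_k)$ fixed. The distribution $\Gamma(\mu,\lambda)$ has density $f(x)=\frac{1}{\Gamma(\mu)}\lambda e^{-\lambda x}(\lambda x)^{\mu-1}$ for $x>0$. With $g_\rho(t)=t^{\rho-1}/\Gamma(\rho)$, for $\alpha\ge0$ the scalar resolvent $s_\alpha:[0,\infty)\to\mathbb R$ is the solution of $s_\alpha(t)+\alpha\int_0^t g_\rho(t-\tau)s_\alpha(\tau)\,d\tau=1$, $t\ge0$; equivalently $s_\alpha(t)=E_\rho(-\alpha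 t^\rho)$ with $E_\rho(z)=\sum_{k\ge0}\frac{z^k}{\Gamma(\rho k+1)}$ the Mittag-Leffler function. $G_\rho^\mu(z)=\sum_{k=0}^\infty\frac{(\mu)_k}{\Gamma(k\rho+1)}z^k$, where $(\mu)_k=\Gamma(\mu+k)/\Gamma(\mu)$. *)

theory Defs
  imports "HOL-Probability.Probability"
begin

definition gamma_density :: "real \<Rightarrow> real \<Rightarrow> real \<Rightarrow> real" where
  "gamma_density \<mu> lam x =
     (if x > 0 then 1 / Gamma \<mu> * lam * exp (- lam * x) * (lam * x) powr (\<mu> - 1) else 0)"

definition frac_kernel :: "real \<Rightarrow> real \<Rightarrow> real" where
  "frac_kernel \<rho> t = t powr (\<rho> - 1) / Gamma \<rho>"

definition solves_resolvent_eq :: "real \<Rightarrow> real \<Rightarrow> (real \<Rightarrow> real) \<Rightarrow> bool" where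
  "solves_resolvent_eq \<rho> a s \<longleftrightarrow>
     continuous_on {0..} s \<and>
     (\<forall>t\<ge>0. s t + a * integral {0..t} (\<lambda>\<tau>. frac_kernel \<rho> (t - \<tau>) * s \<tau>) = 1)"

text \<open>The equation determines a solution on \<open>[0, \<infinity>)\<close> only, so the description picks out the value
  at \<open>t\<close>, on which all solutions agree, rather than a function on the whole real line. The result
  is meaningful for \<open>t \<ge> 0\<close>.\<close>

definition scalar_resolvent :: "real \<Rightarrow> real \<Rightarrow> real \<Rightarrow> real" where
  "scalar_resolvent \<rho> a t = (THE y. \<exists>s. solves_resolvent_eq \<rho> a s \<and> y = s t)"

definition G_fun :: "real \<Rightarrow> real \<Rightarrow> real \<Rightarrow> real" where
  "G_fun \<rho> \<mu> z = (\<Sum>k. pochhammer \<mu> k / Gamma (real k * \<rho> + 1) * z ^ k)"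

text \<open>Only times \<open>t \<ge> 0\<close> are constrained.\<close>

locale standard_brownian_motion = prob_space M for M :: "'a measure" +
  fixes W :: "real \<Rightarrow> 'a \<Rightarrow> real"
  assumes measurable_W: "\<And>t. 0 \<le> t \<Longrightarrow> W t \<in> borel_measurable M"
    and start_zero: "AE \<omega> in M. W 0 \<omega> = 0"
    and indep_increments: "\<And>p n. 0 \<le> p 0 \<Longrightarrow> (\<And>i. i < n \<Longrightarrow> p i \<le> p (Suc i)) \<Longrightarrow>
          indep_vars (\<lambda>_. borel) (\<lambda>i \<omega>. W (p (Suc i)) \<omega> - W (p i) \<omega>) {..<n::nat}"
    and normal_increments: "\<And>s t. 0 \<le> s \<Longrightarrow> s < t \<Longrightarrow>
          distributed M lborel (\<lambda>\<omega>. W t \<omega> - W s \<omega>) (\<lambda>x. ennreal (normal_density 0 (sqrt (t - s)) x))"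
    and continuous_paths: "AE \<omega> in M. continuous_on {0..} (\<lambda>t. W t \<omega>)"

definition is_partition :: "real \<Rightarrow> nat \<Rightarrow> (nat \<Rightarrow> real) \<Rightarrow> bool" where
  "is_partition t n p \<longleftrightarrow> 0 \<le> p 0 \<and> (\<forall>i<n. p i \<le> p (Suc i)) \<and> p n \<le> t"

definition step_fun :: "nat \<Rightarrow> (nat \<Rightarrow> real) \<Rightarrow> (nat \<Rightarrow> real) \<Rightarrow> real \<Rightarrow> real" where
  "step_fun n p c \<tau> = (\<Sum>i<n. c i * indicator {p i<..p (Suc i)} \<tau>)"

definition step_integral ::
    "(real \<Rightarrow> 'a \<Rightarrow> real) \<Rightarrow> nat \<Rightarrow> (nat \<Rightarrow> real) \<Rightarrow> (nat \<Rightarrow> real) \<Rightarrow> 'a \<Rightarrow> real" where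
  "step_integral W n p c \<omega> = (\<Sum>i<n. c i * (W (p (Suc i)) \<omega> - W (p i) \<omega>))"

text \<open>\<open>X\<close> is a version of the Wiener integral of the deterministic function \<open>f\<close> over \<open>[0, t]\<close>:
  step functions converge to \<open>f\<close> in \<open>L\<^sup>2(0, t)\<close> and their integrals converge to \<open>X\<close> in \<open>L\<^sup>2(M)\<close>.
  By the Ito isometry this determines \<open>X\<close> up to null sets, hence a relation and not a function.
  The \<open>L\<^sup>2\<close> distances are nonnegative integrals, so that they are infinite, not zero, if the
  difference is not square integrable.\<close>

definition has_wiener_integral ::
    "'a measure \<Rightarrow> (real \<Rightarrow> 'a \<Rightarrow> real) \<Rightarrow> real \<Rightarrow> (real \<Rightarrow> real) \<Rightarrow> ('a \<Rightarrow> real) \<Rightarrow> bool" where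
  "has_wiener_integral M W t f X \<longleftrightarrow>
     set_borel_measurable lborel {0..t} f \<and> X \<in> borel_measurable M \<and>
     (\<exists>n p c. (\<forall>j::nat. is_partition t (n j) (p j)) \<and>
        (\<lambda>j. \<integral>\<^sup>+\<tau>\<in>{0..t}. ennreal ((f \<tau> - step_fun (n j) (p j) (c j) \<tau>)\<^sup>2) \<partial>lborel)
          \<longlonglongrightarrow> 0 \<and>
        (\<lambda>j. \<integral>\<^sup>+\<omega>. ennreal ((X \<omega> - step_integral W (n j) (p j) (c j) \<omega>)\<^sup>2) \<partial>M)
          \<longlonglongrightarrow> 0)"

end

theory Submission
  imports Defs "HOL-Library.Discrete_Functions"
begin

text \<open>The resolvent \<open>s\<^sub>a\<close> is a power series in \<open>-a t\<^sup>\<rho>\<close>, so both integrands are series in \<open>-t\<^sup>\<rho>\<close> of the same shape: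
  the coefficients of the averaged resolvent carry the empirical moments of the \<open>\<alpha>\<^sub>k\<close>, those of
  \<open>G\<close> the moments of the Gamma distribution. Summation by parts bounds the Wiener integral of a
  difference of such series, uniformly in \<open>t\<close>, by \<open>sup \<bar>W\<bar>\<close> times the variation of the integrand, hence by a weighted
  \<open>l\<^sup>1\<close> distance of the coefficients. That distance tends to \<open>0\<close> almost surely: the strong law gives the
  convergence of each empirical moment, and the strong law for \<open>exp (d \<alpha>\<^sub>k)\<close> gives that of their weighted sum,
  so that Scheffe's lemma for the counting measure applies.\<close>

section \<open>The strong law for nonnegative variables with finite variance\<close>

text \<open>The weights of the \<open>l^1\<close> distance are \<open>d^j / j!\<close>, because the
  weighted sum of the empirical moments is then the empirical mean of
  \<open>exp (d * \<alpha> k)\<close>. They also fit the kernel: \<open>\<rho> > 1\<close> makes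
  \<open>Gamma (j * \<rho> + 1)\<close> outgrow \<open>j!\<close> times every geometric sequence, so
  for any \<open>T\<close> and any \<open>d > 0\<close>, however small, these weights dominate the
  series terms up to time \<open>T\<close>. Hence the probabilistic side alone chooses
  \<open>d\<close>: the strong law proved here rests on second moments, and
  \<open>exp (2 * d * \<alpha> k)\<close> is integrable when \<open>2 * d < lam\<close>. The
  obstacle is that a Wiener integral is determined only up to null sets: for each \<open>n\<close>,
  \<open>t\<close> and realization of the \<open>\<alpha> k\<close> the estimate holds outside its
  own null set of paths. It is therefore put in a form measurable on the product space, collected at
  rational times, and extended by continuity of the paths. The random factor \<open>sup |W|\<close>
  has no deterministic bound, so the path estimate must hold for all constants outside one null
  set.\<close>

lemma tendsto_average_of_square_subsequence:
  fixes S :: "nat \<Rightarrow> real"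
  assumes mono: "mono S" and nonneg: "\<And>n. 0 \<le> S n"
    and lim: "(\<lambda>n. S ((Suc n)\<^sup>2) / real ((Suc n)\<^sup>2)) \<longlonglongrightarrow> m"
  shows "(\<lambda>n. S n / real n) \<longlonglongrightarrow> m"
proof -
  define a where "a n = S (n\<^sup>2) / real (n\<^sup>2)" for n
  have a: "a \<longlonglongrightarrow> m"
    using lim unfolding a_def
    by (subst filterlim_sequentially_Suc[symmetric])
  have k: "filterlim floor_sqrt at_top sequentially"
    unfolding filterlim_at_top
  proof
    fix Z :: nat
    show "\<forall>\<^sub>F n in sequentially. Z \<le> floor_sqrt n"
      using eventually_ge_at_top[of "Z\<^sup>2"] by eventually_elim (simp add: le_floor_sqrt_iff)
  qed
  have l1: "(\<lambda>k. (real k / real (Suc k))\<^sup>2) \<longlonglongrightarrow> 1\<^sup>2"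
    by (intro tendsto_power LIMSEQ_n_over_Suc_n)
  have l2: "(\<lambda>k. (real (Suc k) / real k)\<^sup>2) \<longlonglongrightarrow> 1\<^sup>2"
    by (intro tendsto_power LIMSEQ_Suc_n_over_n)
  have "(\<lambda>k. a k * (real k / real (Suc k))\<^sup>2) \<longlonglongrightarrow> m"
    using tendsto_mult[OF a l1] by simp
  then have lower: "(\<lambda>n. a (floor_sqrt n) * (real (floor_sqrt n) / real (Suc (floor_sqrt n)))\<^sup>2) \<longlonglongrightarrow> m"
    by (rule filterlim_compose[OF _ k])
  have "(\<lambda>k. a (Suc k) * (real (Suc k) / real k)\<^sup>2) \<longlonglongrightarrow> m"
    using tendsto_mult[OF LIMSEQ_Suc[OF a] l2] by simp
  then have upper: "(\<lambda>n. a (Suc (floor_sqrt n)) * (real (Suc (floor_sqrt n)) / real (floor_sqrt n))\<^sup>2) \<longlonglongrightarrow> m"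
    by (rule filterlim_compose[OF _ k])
  \<comment> \<open>With \<open>k = floor_sqrt n\<close> one has
    \<open>k^2 \<le> n \<le> (k+1)^2\<close>, and monotonicity puts \<open>S n / n\<close> between
    \<open>S (k^2) / (k+1)^2\<close> and \<open>S ((k+1)^2) / k^2\<close>. These are the known
    averages up to factors tending to 1.\<close>
  have bounds: "a (floor_sqrt n) * (real (floor_sqrt n) / real (Suc (floor_sqrt n)))\<^sup>2 \<le> S n / real n \<and>
     S n / real n \<le> a (Suc (floor_sqrt n)) * (real (Suc (floor_sqrt n)) / real (floor_sqrt n))\<^sup>2"
    if n: "1 \<le> n" for n
  proof -
    define k where "k = floor_sqrt n"
    have k1: "1 \<le> k" using n unfolding k_def by (simp add: le_floor_sqrt_iff)
    have kn: "k\<^sup>2 \<le> n" unfolding k_def by (rule floor_sqrt_power2_le)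
    have nk: "n \<le> (Suc k)\<^sup>2" unfolding k_def by (rule less_imp_le[OF Suc_floor_sqrt_power2_gt])
    have e1: "a k * (real k / real (Suc k))\<^sup>2 = S (k\<^sup>2) / real ((Suc k)\<^sup>2)"
      using k1 unfolding a_def by (simp add: power_divide del: of_nat_Suc)
    have e2: "a (Suc k) * (real (Suc k) / real k)\<^sup>2 = S ((Suc k)\<^sup>2) / real (k\<^sup>2)"
      using k1 unfolding a_def by (simp add: power_divide del: of_nat_Suc)
    have "S (k\<^sup>2) / real ((Suc k)\<^sup>2) \<le> S n / real n"
      using n nk kn nonneg by (intro frac_le monoD[OF mono]) (auto simp del: of_nat_power of_nat_Suc)
    moreover have "S n / real n \<le> S ((Suc k)\<^sup>2) / real (k\<^sup>2)"
      using n nk kn k1 nonneg by (intro frac_le monoD[OF mono]) (auto simp del: of_nat_power of_nat_Suc)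
    ultimately show ?thesis unfolding e1 e2 k_def[symmetric] by simp
  qed
  show ?thesis
    using bounds by (intro tendsto_sandwich[OF _ _ lower upper])
      (auto intro!: eventually_sequentiallyI[of 1])
qed

text \<open>Independence kills the off-diagonal covariances, and each diagonal term is
  \<open>q - m^2\<close>. Only the linear growth in \<open>card I\<close> matters later, so the
  bound keeps the simpler \<open>q\<close>.\<close>

lemma (in prob_space) expectation_square_centered_sum_le:
  fixes X :: "nat \<Rightarrow> 'a \<Rightarrow> real"
  assumes indep: "indep_vars (\<lambda>_. borel) X I" and fin: "finite I"
    and int2: "\<And>k. k \<in> I \<Longrightarrow> integrable M (\<lambda>\<omega>. (X k \<omega>)\<^sup>2)"
    and mean: "\<And>k. k \<in> I \<Longrightarrow> expectation (X k) = m"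
    and second: "\<And>k. k \<in> I \<Longrightarrow> expectation (\<lambda>\<omega>. (X k \<omega>)\<^sup>2) = q"
  shows "integrable M (\<lambda>\<omega>. (\<Sum>k\<in>I. X k \<omega> - m)\<^sup>2)"
    and "expectation (\<lambda>\<omega>. (\<Sum>k\<in>I. X k \<omega> - m)\<^sup>2) \<le> real (card I) * q"
proof -
  have meas: "\<And>k. k \<in> I \<Longrightarrow> X k \<in> borel_measurable M"
    using indep by (auto simp: indep_vars_def)
  have int: "\<And>k. k \<in> I \<Longrightarrow> integrable M (X k)"
    using int2 meas by (blast intro: square_integrable_imp_integrable)
  have prod: "has_bochner_integral M (\<lambda>\<omega>. (X i \<omega> - m) * (X j \<omega> - m)) (if i = j then q - m\<^sup>2 else 0)"
    if i: "i \<in> I" and j: "j \<in> I" for i j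
  proof (cases "i = j")
    case True
    have "has_bochner_integral M (\<lambda>\<omega>. (X i \<omega>)\<^sup>2 - 2 * m * X i \<omega> + m\<^sup>2) (q - 2 * m * m + m\<^sup>2)"
      using i int int2 mean second prob_space
      by (intro has_bochner_integral_add has_bochner_integral_diff has_bochner_integral_mult_right)
         (auto simp: has_bochner_integral_iff)
    then show ?thesis using True by (simp add: power2_eq_square algebra_simps)
  next
    case False
    have "indep_vars (\<lambda>_. borel) (\<lambda>k \<omega>. X k \<omega> - m) {i, j}"
      using i j by (intro indep_vars_compose2[OF indep_vars_subset[OF indep]]) auto
    moreover have "integrable M (\<lambda>\<omega>. X k \<omega> - m)" if "k \<in> {i, j}" for k
      using that i j int by auto
    ultimately show ?thesis
      using indep_vars_lebesgue_integral[of "{i, j}" "\<lambda>k \<omega>. X k \<omega> - m"]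
        indep_vars_integrable[of "{i, j}" "\<lambda>k \<omega>. X k \<omega> - m"] False i j int mean prob_space
      by (simp add: has_bochner_integral_iff)
  qed
  have eq: "(\<Sum>k\<in>I. X k \<omega> - m)\<^sup>2 = (\<Sum>i\<in>I. \<Sum>j\<in>I. (X i \<omega> - m) * (X j \<omega> - m))" for \<omega>
    by (simp add: power2_eq_square sum_product)
  have "has_bochner_integral M (\<lambda>\<omega>. (\<Sum>k\<in>I. X k \<omega> - m)\<^sup>2)
      (\<Sum>i\<in>I. \<Sum>j\<in>I. if i = j then q - m\<^sup>2 else 0)"
    unfolding eq by (intro has_bochner_integral_sum prod)
  moreover have "(\<Sum>i\<in>I. \<Sum>j\<in>I. if i = j then q - m\<^sup>2 else 0) = real (card I) * (q - m\<^sup>2)"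
    using fin by (simp add: sum.delta)
  ultimately show "integrable M (\<lambda>\<omega>. (\<Sum>k\<in>I. X k \<omega> - m)\<^sup>2)"
    and "expectation (\<lambda>\<omega>. (\<Sum>k\<in>I. X k \<omega> - m)\<^sup>2) \<le> real (card I) * q"
    by (auto simp: has_bochner_integral_iff intro!: mult_left_mono)
qed

text \<open>The bound for the mean square error of the \<open>n\<close>-th average is of order
  \<open>1 / n\<close>, not summable; along the indices \<open>(n+1)^2\<close> it is summable, so
  the errors vanish almost surely there. Nonnegative summands make the partial sums monotone, which
  fills the gaps between squares.\<close>

lemma (in prob_space) strong_law_nonneg:
  fixes X :: "nat \<Rightarrow> 'a \<Rightarrow> real"
  assumes indep: "indep_vars (\<lambda>_. borel) X {1..}"
    and int2: "\<And>k. 1 \<le> k \<Longrightarrow> integrable M (\<lambda>\<omega>. (X k \<omega>)\<^sup>2)"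
    and mean: "\<And>k. 1 \<le> k \<Longrightarrow> expectation (X k) = m"
    and second: "\<And>k. 1 \<le> k \<Longrightarrow> expectation (\<lambda>\<omega>. (X k \<omega>)\<^sup>2) = q"
    and nonneg: "\<And>k. 1 \<le> k \<Longrightarrow> AE \<omega> in M. 0 \<le> X k \<omega>"
  shows "AE \<omega> in M. (\<lambda>n. (\<Sum>k=1..n. X k \<omega>) / real n) \<longlonglongrightarrow> m"
proof -
  define S where "S n \<omega> = (\<Sum>k=1..n. X k \<omega>)" for n \<omega>
  define D where "D n \<omega> = S ((Suc n)\<^sup>2) \<omega> / real ((Suc n)\<^sup>2) - m" for n \<omega>
  have measX: "\<And>k. k \<in> {1..} \<Longrightarrow> X k \<in> borel_measurable M"
    using indep by (auto simp: indep_vars_def)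
  have measS[measurable]: "S n \<in> borel_measurable M" for n
    unfolding S_def using measX by (intro borel_measurable_sum) auto
  have q: "0 \<le> q" using second[of 1] by (auto simp flip: second)
  have nD: "(\<integral>\<^sup>+\<omega>. ennreal ((D n \<omega>)\<^sup>2) \<partial>M) \<le> ennreal (q * inverse ((real (Suc n))\<^sup>2))" for n
  proof -
    define N where "N = (Suc n)\<^sup>2"
    have N: "real N > 0" by (simp add: N_def)
    have *: "(D n \<omega>)\<^sup>2 = (\<Sum>k=1..N. X k \<omega> - m)\<^sup>2 * inverse ((real N)\<^sup>2)" for \<omega>
      using N by (simp add: D_def S_def N_def[symmetric] sum_subtractf field_simps)
    have ind: "indep_vars (\<lambda>_. borel) X {1..N}"
      by (rule indep_vars_subset[OF indep]) auto
    note E = expectation_square_centered_sum_le[OF ind, of m q]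
    have i: "integrable M (\<lambda>\<omega>. (\<Sum>k=1..N. X k \<omega> - m)\<^sup>2)"
      and e: "expectation (\<lambda>\<omega>. (\<Sum>k=1..N. X k \<omega> - m)\<^sup>2) \<le> real N * q"
      using E int2 mean second by auto
    have "(\<integral>\<^sup>+\<omega>. ennreal ((D n \<omega>)\<^sup>2) \<partial>M) =
        ennreal (expectation (\<lambda>\<omega>. (\<Sum>k=1..N. X k \<omega> - m)\<^sup>2) * inverse ((real N)\<^sup>2))"
      unfolding * using i by (subst nn_integral_eq_integral) auto
    also have "\<dots> \<le> ennreal (real N * q * inverse ((real N)\<^sup>2))"
      using e by (intro ennreal_leI mult_right_mono) auto
    also have "real N * q * inverse ((real N)\<^sup>2) = q * inverse ((real (Suc n))\<^sup>2)"
      using N unfolding N_def[symmetric] of_nat_power[symmetric]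
      by (simp add: power2_eq_square field_simps)
    finally show ?thesis .
  qed
  have sm: "summable (\<lambda>n. q * inverse ((real (Suc n))\<^sup>2))"
    by (intro summable_mult) (use inverse_power_summable[of 2] in \<open>subst summable_Suc_iff, simp\<close>)
  have measD[measurable]: "D n \<in> borel_measurable M" for n
    unfolding D_def by measurable
  have "(\<integral>\<^sup>+\<omega>. (\<Sum>n. ennreal ((D n \<omega>)\<^sup>2)) \<partial>M) = (\<Sum>n. \<integral>\<^sup>+\<omega>. ennreal ((D n \<omega>)\<^sup>2) \<partial>M)"
    by (intro nn_integral_suminf) measurable
  also have "\<dots> \<le> (\<Sum>n. ennreal (q * inverse ((real (Suc n))\<^sup>2)))"
    by (intro suminf_le nD) auto
  also have "\<dots> < \<infinity>"
    using q sm by (subst suminf_ennreal2) auto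
  \<comment> \<open>A finite expected sum of squares makes the sum finite almost surely, so its
    terms tend to 0; this takes the place of Chebyshev and Borel-Cantelli.\<close>
  finally have "(\<integral>\<^sup>+\<omega>. (\<Sum>n. ennreal ((D n \<omega>)\<^sup>2)) \<partial>M) \<noteq> \<infinity>" by simp
  then have AE1: "AE \<omega> in M. (\<Sum>n. ennreal ((D n \<omega>)\<^sup>2)) \<noteq> \<infinity>"
    by (intro nn_integral_noteq_infinite) measurable
  have AE2: "AE \<omega> in M. \<forall>k\<in>{1..}. 0 \<le> X k \<omega>"
    using nonneg by (subst AE_ball_countable) auto
  from AE1 AE2 show ?thesis
  proof eventually_elim
    case (elim \<omega>)
    have "summable (\<lambda>n. (D n \<omega>)\<^sup>2)"
      using elim(1) by (intro summable_suminf_not_top) auto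
    then have "(\<lambda>n. (D n \<omega>)\<^sup>2) \<longlonglongrightarrow> 0" by (rule summable_LIMSEQ_zero)
    then have "(\<lambda>n. D n \<omega>) \<longlonglongrightarrow> 0"
      using tendsto_real_sqrt by (fastforce intro: tendsto_rabs_zero_cancel)
    then have lim: "(\<lambda>n. S ((Suc n)\<^sup>2) \<omega> / real ((Suc n)\<^sup>2)) \<longlonglongrightarrow> m"
      unfolding D_def by (subst (asm) LIM_zero_iff)
    have "mono (\<lambda>n. S n \<omega>)"
      unfolding S_def using elim(2) by (intro monoI sum_mono2) auto
    moreover have "0 \<le> S n \<omega>" for n
      unfolding S_def using elim(2) by (intro sum_nonneg) auto
    ultimately show ?case
      using tendsto_average_of_square_subsequence[OF _ _ lim] unfolding S_def by blast
  qed
qed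

section \<open>The scalar resolvent\<close>

text \<open>Gamma values are integrals of powers against the probability density
  \<open>exp (- t)\<close>, so a pointwise inequality between powers integrates to one between Gamma
  values: an elementary substitute for Stirling.\<close>

lemma Gamma_mult_le:
  fixes p q :: real
  assumes "0 \<le> p" "0 \<le> q" and le: "\<And>t. 0 < t \<Longrightarrow> a * t powr p \<le> t powr q + b"
  shows "a * Gamma (p + 1) \<le> Gamma (q + 1) + b"
proof (rule has_integral_le)
  show "((\<lambda>t. a * (t powr (p + 1 - 1) / exp t)) has_integral a * Gamma (p + 1)) {0..}"
    using assms by (intro has_integral_mult_right Gamma_integral_real) auto
  \<comment> \<open>The constant is written as \<open>b * t powr (1 - 1)\<close>, hence integrates
    to \<open>b * Gamma 1\<close>; at \<open>t = 0\<close> every power is 0 by convention.\<close>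
  have "((\<lambda>t. t powr (q + 1 - 1) / exp t + b * (t powr (1 - 1) / exp t)) has_integral Gamma (q + 1) + b * Gamma 1) {0..}"
    using assms by (intro has_integral_add has_integral_mult_right Gamma_integral_real) auto
  then show "((\<lambda>t. t powr (q + 1 - 1) / exp t + b * (t powr (1 - 1) / exp t)) has_integral Gamma (q + 1) + b) {0..}"
    by simp
  fix t :: real assume "t \<in> {0..}"
  then show "a * (t powr (p + 1 - 1) / exp t) \<le> t powr (q + 1 - 1) / exp t + b * (t powr (1 - 1) / exp t)"
    using le[of t] by (cases "t = 0") (auto simp: field_simps)
qed

text \<open>The inequality \<open>t^k \<le> t powr (k * \<rho>) + 1\<close> holds for all
  \<open>t > 0\<close>, the \<open>1\<close> covering \<open>t \<le> 1\<close>. Integrated, it adds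
  1 to the Gamma value, and the lower bound 1 for that value turns this into the factor 2.\<close>

lemma fact_le_Gamma:
  fixes \<rho> :: real
  assumes "1 \<le> \<rho>"
  shows "fact k \<le> 2 * Gamma (real k * \<rho> + 1)" and "1 \<le> Gamma (real k * \<rho> + 1)"
proof -
  show *: "1 \<le> Gamma (real k * \<rho> + 1)"
  proof (cases "k = 0")
    \<comment> \<open>\<open>Gamma\<close> drops below 1 between 1 and 2, but for
      \<open>k > 0\<close> the argument is at least 2, where it is increasing.\<close>
    case False
    then have "1 * 1 \<le> real k * \<rho>" using assms by (intro mult_mono) auto
    then have "Gamma 2 \<le> Gamma (real k * \<rho> + 1)"
      using Gamma_real_strict_mono[of 2 "real k * \<rho> + 1"] by (cases "real k * \<rho> = 1") auto
    then show ?thesis using Gamma_numeral[of "num.Bit0 num.One", where ?'a=real] by simp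
  qed simp
  have "1 * Gamma (real k + 1) \<le> Gamma (real k * \<rho> + 1) + 1"
  proof (rule Gamma_mult_le)
    fix t :: real assume t: "0 < t"
    have "real k * 1 \<le> real k * \<rho>" using assms by (intro mult_left_mono) auto
    then show "1 * t powr real k \<le> t powr (real k * \<rho>) + 1"
      using t powr_mono[of "real k" "real k * \<rho>" t] powr_le1[of "real k" t]
      by (cases "t \<le> 1") (auto intro: add_increasing add_increasing2)
  qed (use assms in auto)
  with * show "fact k \<le> 2 * Gamma (real k * \<rho> + 1)"
    by (simp add: Gamma_fact add.commute)
qed

lemma power_div_fact_le_exp: "0 \<le> x \<Longrightarrow> x ^ k / fact k \<le> exp (x::real)"
  using sum_le_suminf[OF summable_exp, of "{k}" x] exp_converges[of x]
  by (auto simp: sums_iff field_simps)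

text \<open>The scales \<open>x\<close> and \<open>d\<close> are unrelated: since
  \<open>\<rho> > 1\<close>, the Gamma value absorbs \<open>(x / d)^k\<close> on top of
  \<open>k!\<close>. With \<open>x = T powr \<rho>\<close> this controls the series on the whole
  time interval by the weights of any chosen \<open>d\<close>.\<close>

lemma inverse_Gamma_bound:
  fixes \<rho> x d :: real
  assumes "1 < \<rho>" "0 < x" "0 < d"
  obtains C where "0 \<le> C" "\<And>k. x ^ k / Gamma (real k * \<rho> + 1) \<le> C * (d ^ k / fact k)"
proof
  define y where "y = x / d"
  have y: "0 < y" using assms by (simp add: y_def)
  \<comment> \<open>\<open>L\<close> solves \<open>L powr (\<rho> - 1) = y\<close>. For
    \<open>t > L\<close> the factor \<open>y^k\<close> is absorbed by
    \<open>t powr (k * (\<rho> - 1))\<close>; for \<open>t \<le> L\<close> the product is at most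
    \<open>(y * L)^k\<close>, which is at most \<open>exp (y * L) * k!\<close>. Hence the constant
    \<open>1 + 2 * exp (y * L)\<close>.\<close>
  define L where "L = y powr (1 / (\<rho> - 1))"
  have L: "0 < L" using y by (simp add: L_def)
  show "0 \<le> 1 + 2 * exp (y * L)" by (simp add: add_nonneg_nonneg)
  fix k
  let ?G = "Gamma (real k * \<rho> + 1)"
  have G1: "1 \<le> ?G" and fG: "fact k \<le> 2 * ?G" using fact_le_Gamma[of \<rho> k] assms by auto
  have "y ^ k * Gamma (real k + 1) \<le> ?G + (y * L) ^ k"
  proof (rule Gamma_mult_le)
    fix t :: real assume t: "0 < t"
    show "y ^ k * t powr real k \<le> t powr (real k * \<rho>) + (y * L) ^ k"
    proof (cases "t \<le> L")
      case True
      then have "y ^ k * t ^ k \<le> y ^ k * L ^ k"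
        using t y by (intro mult_left_mono power_mono) auto
      then show ?thesis using t by (simp add: powr_realpow power_mult_distrib add_increasing)
    next
      case False
      have "y = L powr (\<rho> - 1)" using assms y by (simp add: L_def powr_powr)
      also have "\<dots> \<le> t powr (\<rho> - 1)" using False L assms by (intro powr_mono2) auto
      finally have "y ^ k * t powr real k \<le> (t powr (\<rho> - 1)) ^ k * t powr real k"
        using y by (intro mult_right_mono power_mono) auto
      also have "\<dots> = t powr (real k * \<rho>)"
        using t by (simp add: powr_power powr_add[symmetric] algebra_simps)
      finally show ?thesis using y L by (simp add: add_increasing2)
    qed
  qed (use assms in auto)
  then have "y ^ k * fact k \<le> ?G + (y * L) ^ k"
    by (simp add: Gamma_fact add.commute)
  also have "(y * L) ^ k \<le> exp (y * L) * fact k"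
    using power_div_fact_le_exp[of "y * L" k] y L by (simp add: field_simps)
  also have "\<dots> \<le> exp (y * L) * (2 * ?G)" by (intro mult_left_mono fG) auto
  finally have "y ^ k * fact k \<le> (1 + 2 * exp (y * L)) * ?G" by (simp add: algebra_simps)
  then show "x ^ k / ?G \<le> (1 + 2 * exp (y * L)) * (d ^ k / fact k)"
    using G1 assms by (simp add: y_def power_divide field_simps)
qed

text \<open>The power \<open>u\<^sup>k\<^sup>\<rho>\<close> is written as an iterated power because \<open>0 powr 0 = 0\<close>.\<close>

definition frac_series :: "real \<Rightarrow> (nat \<Rightarrow> real) \<Rightarrow> real \<Rightarrow> real" where
  "frac_series \<rho> c u = (\<Sum>k. c k / Gamma (real k * \<rho> + 1) * (- (u powr \<rho>)) ^ k)"

lemma summable_power_div_Gamma: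
  fixes \<rho> z :: real
  assumes "1 < \<rho>"
  shows "summable (\<lambda>k. \<bar>z ^ k / Gamma (real k * \<rho> + 1)\<bar>)"
proof -
  \<comment> \<open>The \<open>+ 1\<close> keeps the base positive at \<open>z = 0\<close>, as the
    bound requires.\<close>
  obtain C where C: "0 \<le> C" "\<And>k. (\<bar>z\<bar> + 1) ^ k / Gamma (real k * \<rho> + 1) \<le> C * (1 ^ k / fact k)"
    using inverse_Gamma_bound[of \<rho> "\<bar>z\<bar> + 1" 1] assms by (auto simp: add_pos_nonneg add_nonneg_pos)
  have G: "1 \<le> Gamma (real k * \<rho> + 1)" for k using fact_le_Gamma(2)[of \<rho> k] assms by auto
  have "summable (\<lambda>k. C * (1 ^ k / fact k))"
    using summable_exp[of "1::real"] by (intro summable_mult) (simp add: field_simps)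
  then show ?thesis
  proof (rule summable_comparison_test'[of _ 0])
    fix k
    have "\<bar>z ^ k / Gamma (real k * \<rho> + 1)\<bar> \<le> (\<bar>z\<bar> + 1) ^ k / Gamma (real k * \<rho> + 1)"
      using G[of k] by (auto simp: power_abs intro!: divide_right_mono power_mono)
    also note C(2)
    finally show "norm \<bar>z ^ k / Gamma (real k * \<rho> + 1)\<bar> \<le> C * (1 ^ k / fact k)" by simp
  qed
qed

section \<open>Power series solution of the resolvent equation\<close>

text \<open>The substitution \<open>\<tau> = t * u\<close> reduces this to the Beta
  integral.\<close>

lemma has_integral_powr_convolution:
  fixes a b t :: real
  assumes "0 < a" "0 < b" "0 < t"
  shows "((\<lambda>\<tau>. (t - \<tau>) powr (a - 1) * \<tau> powr (b - 1)) has_integral Beta a b * t powr (a + b - 1)) {0..t}"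
proof -
  have "((\<lambda>\<tau>. \<tau> powr (b - 1) * (1 - \<tau>) powr (a - 1)) has_integral Beta b a) (cbox 0 1)"
    using has_integral_Beta_real[of b a] assms by simp
  from has_integral_affinity'[OF this, of "1 / t" 0]
  have "((\<lambda>\<tau>. (\<tau> / t) powr (b - 1) * (1 - \<tau> / t) powr (a - 1)) has_integral Beta b a * t) {0..t}"
    using assms by (simp add: mult.commute)
  moreover have e0: "t powr (a + b - 2) * (Beta b a * t) = Beta a b * t powr (a + b - 1)"
    using assms powr_mult_base[of t "a + b - 2"] by (simp add: Beta_commute[of b a] mult.assoc[symmetric] mult.commute)
  ultimately
  have "((\<lambda>\<tau>. t powr (a + b - 2) * ((\<tau> / t) powr (b - 1) * (1 - \<tau> / t) powr (a - 1)))
      has_integral Beta a b * t powr (a + b - 1)) {0..t}"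
    using has_integral_mult_right[of _ "Beta b a * t" _ "t powr (a + b - 2)"] unfolding e0[symmetric] by blast
  then show ?thesis
  proof (rule has_integral_eq[rotated])
    fix \<tau> assume \<tau>: "\<tau> \<in> {0..t}"
    have e: "1 - \<tau> / t = (t - \<tau>) / t" using assms by (simp add: field_simps)
    have "t powr (a + b - 2) = t powr (b - 1) * t powr (a - 1)"
      by (simp add: powr_add[symmetric] algebra_simps)
    then show "t powr (a + b - 2) * ((\<tau> / t) powr (b - 1) * (1 - \<tau> / t) powr (a - 1)) = (t - \<tau>) powr (a - 1) * \<tau> powr (b - 1)"
      unfolding e using \<tau> assms by (simp add: powr_divide)
  qed
qed

text \<open>Convolution with the kernel sends the \<open>k\<close>-th term of the Mittag-Leffler
  series to the next: \<open>Beta \<rho> (k * \<rho> + 1)\<close> cancels the two Gamma factors and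
  leaves \<open>1 / Gamma ((k+1) * \<rho> + 1)\<close>.\<close>

lemma has_integral_frac_kernel_power:
  fixes \<rho> t :: real
  assumes "1 < \<rho>" "0 < t"
  shows "((\<lambda>\<tau>. frac_kernel \<rho> (t - \<tau>) * ((\<tau> powr \<rho>) ^ k / Gamma (real k * \<rho> + 1))) has_integral
           (t powr \<rho>) ^ Suc k / Gamma (real (Suc k) * \<rho> + 1)) {0..t}"
proof -
  let ?b = "real k * \<rho> + 1"
  have b: "0 < ?b" using assms by (intro add_nonneg_pos) auto
  have G: "Gamma \<rho> > 0" "Gamma ?b > 0" using assms b by (auto intro: Gamma_real_pos)
  have t: "t powr (\<rho> + ?b - 1) = (t powr \<rho>) ^ Suc k"
  proof -
    have "(t powr \<rho>) ^ k = t powr (real k * \<rho>)"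
      using powr_power[of t \<rho> k] assms by (simp add: mult.commute)
    moreover have "\<rho> + ?b - 1 = \<rho> + real k * \<rho>" by simp
    ultimately show ?thesis by (simp only: powr_add power_Suc)
  qed
  have B: "Beta \<rho> ?b / (Gamma \<rho> * Gamma ?b) = 1 / Gamma (real (Suc k) * \<rho> + 1)"
    using G by (simp add: Beta_def algebra_simps)
  have "((\<lambda>\<tau>. 1 / (Gamma \<rho> * Gamma ?b) * ((t - \<tau>) powr (\<rho> - 1) * \<tau> powr (?b - 1))) has_integral
      1 / (Gamma \<rho> * Gamma ?b) * (Beta \<rho> ?b * t powr (\<rho> + ?b - 1))) {0..t}"
    using assms b by (intro has_integral_mult_right has_integral_powr_convolution) auto
  also have "1 / (Gamma \<rho> * Gamma ?b) * (Beta \<rho> ?b * t powr (\<rho> + ?b - 1)) =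
      Beta \<rho> ?b / (Gamma \<rho> * Gamma ?b) * (t powr \<rho>) ^ Suc k"
    by (simp only: t) simp
  also have "\<dots> = (t powr \<rho>) ^ Suc k / Gamma (real (Suc k) * \<rho> + 1)"
    by (simp only: B) simp
  \<comment> \<open>The identity of the integrands fails at \<open>\<tau> = 0\<close> for
    \<open>k = 0\<close>, where the iterated power is 1 but \<open>0 powr 0\<close> is 0; one point
    is negligible.\<close>
  finally show ?thesis
  proof (rule has_integral_spike[of "{0}", rotated 2])
    fix \<tau> assume \<tau>: "\<tau> \<in> {0..t} - {0}"
    then have "(\<tau> powr \<rho>) ^ k = \<tau> powr (?b - 1)" by (simp add: powr_power mult.commute)
    then show "frac_kernel \<rho> (t - \<tau>) * ((\<tau> powr \<rho>) ^ k / Gamma ?b) =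
      1 / (Gamma \<rho> * Gamma ?b) * ((t - \<tau>) powr (\<rho> - 1) * \<tau> powr (?b - 1))"
      by (simp add: frac_kernel_def)
  qed auto
qed

lemma continuous_on_frac_kernel:
  assumes "1 < \<rho>"
  shows "continuous_on {0..t} (\<lambda>\<tau>. frac_kernel \<rho> (t - \<tau>))"
  unfolding frac_kernel_def using assms Gamma_real_pos[of \<rho>]
  by (intro continuous_intros continuous_on_powr') (auto simp: less_imp_neq[symmetric])

lemma frac_kernel_bound:
  assumes "1 < \<rho>" "\<tau> \<in> {0..t}" "t \<le> T"
  shows "0 \<le> frac_kernel \<rho> (t - \<tau>)" "frac_kernel \<rho> (t - \<tau>) \<le> frac_kernel \<rho> T"
  unfolding frac_kernel_def using assms Gamma_real_pos[of \<rho>]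
  by (auto intro!: divide_right_mono powr_mono2 divide_nonneg_pos)

lemma frac_series_power:
  "frac_series \<rho> (\<lambda>k. a ^ k) t = (\<Sum>k. (- (a * t powr \<rho>)) ^ k / Gamma (real k * \<rho> + 1))"
  unfolding frac_series_def by (intro suminf_cong) (simp add: power_mult_distrib[symmetric])

text \<open>Termwise convolution shifts the series by one index and \<open>- a\<close> restores the
  coefficients, so the integral term cancels everything except the head term 1. Dominated
  convergence justifies integrating term by term.\<close>

lemma frac_series_solves_resolvent_eq:
  assumes "1 < \<rho>"
  shows "solves_resolvent_eq \<rho> a (frac_series \<rho> (\<lambda>k. a ^ k))"
  unfolding solves_resolvent_eq_def
proof (intro conjI allI impI)
  define E where "E z = (\<Sum>k. 1 / Gamma (real k * \<rho> + 1) * z ^ k)" for z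
  have sm: "summable (\<lambda>k. 1 / Gamma (real k * \<rho> + 1) * z ^ k)" for z
    using summable_rabs_cancel[OF summable_power_div_Gamma[OF assms, of z]] by simp
  have cE: "isCont E z" for z
    unfolding E_def by (rule isCont_powser_converges_everywhere[OF sm])
  have eq: "frac_series \<rho> (\<lambda>k. a ^ k) t = E (- (a * t powr \<rho>))" for t
    by (simp add: frac_series_power E_def)
  have "continuous_on {0..} (\<lambda>t. - (a * t powr \<rho>))"
    using assms by (intro continuous_intros continuous_on_powr') auto
  then show "continuous_on {0..} (frac_series \<rho> (\<lambda>k. a ^ k))"
    unfolding eq[abs_def]
    by (rule continuous_on_compose2[of UNIV E, rotated])
      (auto intro!: continuous_at_imp_continuous_on cE)
  fix t :: real assume "0 \<le> t"
  show "frac_series \<rho> (\<lambda>k. a ^ k) t +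
      a * integral {0..t} (\<lambda>\<tau>. frac_kernel \<rho> (t - \<tau>) * frac_series \<rho> (\<lambda>k. a ^ k) \<tau>) = 1"
  proof (cases "t = 0")
    case True
    have "frac_series \<rho> (\<lambda>k. a ^ k) 0 = 1"
      unfolding frac_series_power by (simp add: powser_zero[where f="\<lambda>k. 1 / Gamma (real k * \<rho> + 1)", simplified])
    then show ?thesis using True by simp
  next
    case False
    with \<open>0 \<le> t\<close> have t: "0 < t" by simp
    let ?u = "\<lambda>k \<tau>. (- (a * \<tau> powr \<rho>)) ^ k / Gamma (real k * \<rho> + 1)"
    let ?I = "\<lambda>k. (- a) ^ k * ((t powr \<rho>) ^ Suc k / Gamma (real (Suc k) * \<rho> + 1))"
    have pm: "(- (a * x)) ^ k = (- a) ^ k * x ^ k" for x k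
      by (metis minus_mult_left power_mult_distrib)
    have part: "((\<lambda>\<tau>. frac_kernel \<rho> (t - \<tau>) * (\<Sum>k<n. ?u k \<tau>)) has_integral (\<Sum>k<n. ?I k)) {0..t}" for n
    proof -
      have "((\<lambda>\<tau>. \<Sum>k<n. (- a) ^ k * (frac_kernel \<rho> (t - \<tau>) * ((\<tau> powr \<rho>) ^ k / Gamma (real k * \<rho> + 1))))
          has_integral (\<Sum>k<n. ?I k)) {0..t}"
        by (intro has_integral_sum has_integral_mult_right has_integral_frac_kernel_power assms t) auto
      then show ?thesis
        by (rule has_integral_eq[rotated]) (auto simp: sum_distrib_left pm intro!: sum.cong)
    qed
    have uI: "(\<lambda>k. ?u (Suc k) t) = (\<lambda>k. - a * ?I k)"
      by (simp add: fun_eq_iff pm)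
    \<comment> \<open>\<open>?I\<close> is the shifted series divided by \<open>- a\<close>; for
      \<open>a = 0\<close> only its term \<open>k = 0\<close> survives.\<close>
    have sI: "summable ?I"
    proof (cases "a = 0")
      case True
      then show ?thesis by (intro summable_finite[of "{0}"]) auto
    next
      case False
      have "summable (\<lambda>k. - a * ?I k)"
        unfolding uI[symmetric] using sm by (subst summable_Suc_iff) simp
      with False show ?thesis using iffD1[OF summable_cmult_iff] by (metis neg_equal_0_iff_equal)
    qed
    \<comment> \<open>The value at time \<open>t\<close> of the series with absolute values: it
      bounds all partial sums on \<open>{0..t}\<close>.\<close>
    define B where "B = E (\<bar>a\<bar> * t powr \<rho>)"
    have "((\<lambda>\<tau>. frac_kernel \<rho> (t - \<tau>) * frac_series \<rho> (\<lambda>k. a ^ k) \<tau>) has_integral (\<Sum>k. ?I k)) {0..t}"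
    proof (rule has_integral_dominated_convergence[OF part, where h="\<lambda>\<tau>. frac_kernel \<rho> t * B"])
      fix n
      show "\<forall>\<tau>\<in>{0..t}. norm (frac_kernel \<rho> (t - \<tau>) * (\<Sum>k<n. ?u k \<tau>)) \<le> frac_kernel \<rho> t * B"
      proof
        fix \<tau> assume \<tau>: "\<tau> \<in> {0..t}"
        have "\<bar>\<Sum>k<n. ?u k \<tau>\<bar> \<le> (\<Sum>k<n. \<bar>?u k \<tau>\<bar>)" by (rule sum_abs)
        also have "\<dots> \<le> (\<Sum>k<n. 1 / Gamma (real k * \<rho> + 1) * (\<bar>a\<bar> * t powr \<rho>) ^ k)"
        proof (rule sum_mono)
          fix k
          have "\<bar>(- (a * \<tau> powr \<rho>)) ^ k\<bar> \<le> (\<bar>a\<bar> * t powr \<rho>) ^ k"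
            unfolding power_abs using \<tau> assms
            by (intro power_mono) (auto simp: abs_mult intro!: mult_left_mono powr_mono2)
          then show "\<bar>?u k \<tau>\<bar> \<le> 1 / Gamma (real k * \<rho> + 1) * (\<bar>a\<bar> * t powr \<rho>) ^ k"
            using fact_le_Gamma(2)[of \<rho> k] assms by (auto simp: field_simps)
        qed
        also have "\<dots> \<le> B"
          unfolding B_def E_def using fact_le_Gamma(2)[of \<rho>] assms
          by (intro sum_le_suminf sm) (auto intro!: divide_nonneg_nonneg intro: order_trans[OF zero_le_one])
        finally show "norm (frac_kernel \<rho> (t - \<tau>) * (\<Sum>k<n. ?u k \<tau>)) \<le> frac_kernel \<rho> t * B"
          using frac_kernel_bound[OF assms \<tau>, of t] by (auto simp: abs_mult intro!: mult_mono)
      qed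
    next
      show "(\<lambda>\<tau>. frac_kernel \<rho> t * B) integrable_on {0..t}" by (rule integrable_const_ivl)
      show "\<forall>\<tau>\<in>{0..t}. (\<lambda>n. frac_kernel \<rho> (t - \<tau>) * (\<Sum>k<n. ?u k \<tau>))
          \<longlonglongrightarrow> frac_kernel \<rho> (t - \<tau>) * frac_series \<rho> (\<lambda>k. a ^ k) \<tau>"
        unfolding frac_series_power using sm
        by (intro ballI tendsto_mult_left summable_LIMSEQ) auto
      show "(\<lambda>n. \<Sum>k<n. ?I k) \<longlonglongrightarrow> (\<Sum>k. ?I k)"
        by (rule summable_LIMSEQ[OF sI])
    qed
    then have I: "integral {0..t} (\<lambda>\<tau>. frac_kernel \<rho> (t - \<tau>) * frac_series \<rho> (\<lambda>k. a ^ k) \<tau>) = (\<Sum>k. ?I k)"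
      by (rule integral_unique)
    have "frac_series \<rho> (\<lambda>k. a ^ k) t = (\<Sum>k. ?u (Suc k) t) + 1"
      unfolding frac_series_power using sm by (subst suminf_split_head) auto
    also have "(\<Sum>k. ?u (Suc k) t) = - a * (\<Sum>k. ?I k)"
      unfolding uI using sI by (rule suminf_mult)
    finally show ?thesis unfolding I by simp
  qed
qed

section \<open>Uniqueness for the resolvent equation\<close>

text \<open>Gronwall by iteration: inserting the bound into itself \<open>n\<close> times yields
  \<open>M * (K * t)^n / n!\<close>, which tends to 0.\<close>

lemma integral_inequality_imp_zero:
  fixes d :: "real \<Rightarrow> real"
  assumes cont: "continuous_on {0..T} d" and "0 \<le> K"
    and le: "\<And>t. t \<in> {0..T} \<Longrightarrow> \<bar>d t\<bar> \<le> K * integral {0..t} (\<lambda>\<tau>. \<bar>d \<tau>\<bar>)"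
    and t: "t \<in> {0..T}"
  shows "d t = 0"
proof -
  have "bounded (d ` {0..T})" using cont by (intro compact_imp_bounded compact_continuous_image) auto
  then obtain M where M: "\<And>t. t \<in> {0..T} \<Longrightarrow> \<bar>d t\<bar> \<le> M" unfolding bounded_iff by fastforce
  have bd: "\<forall>t\<in>{0..T}. \<bar>d t\<bar> \<le> M * ((K * t) ^ n / fact n)" for n
  proof (induction n)
    case 0
    then show ?case using M by simp
  next
    case (Suc n)
    show ?case
    proof
      fix t assume t: "t \<in> {0..T}"
      have i: "((\<lambda>\<tau>. M * (K ^ n / fact n) * \<tau> ^ n) has_integral M * (K ^ n / fact n) * (t ^ Suc n / real (Suc n))) {0..t}"
      proof (intro has_integral_mult_right)
        have "((\<lambda>\<tau>. \<tau> ^ n) has_integral t ^ Suc n / real (Suc n) - 0 ^ Suc n / real (Suc n)) {0..t}"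
        proof (rule fundamental_theorem_of_calculus)
          fix x assume "x \<in> {0..t}"
          have "((\<lambda>x. x ^ Suc n / real (Suc n)) has_real_derivative x ^ n) (at x within {0..t})"
            using DERIV_cdivide[OF DERIV_pow[of "Suc n" x "{0..t}"], of "real (Suc n)"]
            by (simp del: of_nat_Suc power_Suc)
          then show "((\<lambda>x. x ^ Suc n / real (Suc n)) has_vector_derivative x ^ n) (at x within {0..t})"
            by (simp only: has_real_derivative_iff_has_vector_derivative)
        qed (use t in auto)
        then show "((\<lambda>\<tau>. \<tau> ^ n) has_integral t ^ Suc n / real (Suc n)) {0..t}" by simp
      qed
      have "\<bar>d t\<bar> \<le> K * integral {0..t} (\<lambda>\<tau>. \<bar>d \<tau>\<bar>)" using le t by blast
      also have "integral {0..t} (\<lambda>\<tau>. \<bar>d \<tau>\<bar>) \<le> M * (K ^ n / fact n) * (t ^ Suc n / real (Suc n))"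
      proof (rule has_integral_le[OF integrable_integral i])
        show "(\<lambda>\<tau>. \<bar>d \<tau>\<bar>) integrable_on {0..t}"
          using t by (intro integrable_continuous_real continuous_on_rabs continuous_on_subset[OF cont]) auto
        show "\<bar>d \<tau>\<bar> \<le> M * (K ^ n / fact n) * \<tau> ^ n" if "\<tau> \<in> {0..t}" for \<tau>
          using bspec[OF Suc.IH, of \<tau>] that t by (auto simp: power_mult_distrib)
      qed
      also have "K * (M * (K ^ n / fact n) * (t ^ Suc n / real (Suc n))) = M * ((K * t) ^ Suc n / fact (Suc n))"
        by (simp add: power_mult_distrib field_simps del: of_nat_Suc)
      finally show "\<bar>d t\<bar> \<le> M * ((K * t) ^ Suc n / fact (Suc n))"
        using \<open>0 \<le> K\<close> by (simp add: mult_left_mono)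
    qed
  qed
  have "(\<lambda>n. M * ((K * t) ^ n / fact n)) \<longlonglongrightarrow> M * 0"
    using summable_LIMSEQ_zero[OF summable_exp[of "K * t"]]
    by (intro tendsto_mult_left) (simp add: field_simps)
  moreover have "\<bar>d t\<bar> \<le> M * ((K * t) ^ n / fact n)" for n using bd t by blast
  ultimately have "\<bar>d t\<bar> \<le> 0"
    by (intro LIMSEQ_le_const[of _ "M * 0", simplified]) auto
  then show ?thesis by simp
qed

text \<open>For \<open>\<rho> > 1\<close> the kernel has no singularity and stays below
  \<open>frac_kernel \<rho> t\<close> on the time interval, so the difference of two solutions
  satisfies a Gronwall inequality with a constant factor.\<close>

lemma solves_resolvent_eq_unique:
  assumes "1 < \<rho>" and s: "solves_resolvent_eq \<rho> a s" and r: "solves_resolvent_eq \<rho> a r" and "0 \<le> t"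
  shows "s t = r t"
proof -
  let ?d = "\<lambda>t. s t - r t"
  have c: "continuous_on {0..} s" "continuous_on {0..} r"
    using s r by (auto simp: solves_resolvent_eq_def)
  have cd: "continuous_on {0..u} ?d" for u
    using c by (intro continuous_on_diff) (auto intro: continuous_on_subset)
  have "?d t = 0"
  proof (rule integral_inequality_imp_zero[OF cd, where T=t and K="\<bar>a\<bar> * frac_kernel \<rho> t"])
    show "0 \<le> \<bar>a\<bar> * frac_kernel \<rho> t"
      using frac_kernel_bound(1)[OF \<open>1 < \<rho>\<close>, of 0 t t] \<open>0 \<le> t\<close> by simp
    fix u assume u: "u \<in> {0..t}"
    have int: "(\<lambda>\<tau>. frac_kernel \<rho> (u - \<tau>) * f \<tau>) integrable_on {0..u}" if "continuous_on {0..} f" for f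
      using that continuous_on_frac_kernel[OF \<open>1 < \<rho>\<close>]
      by (intro integrable_continuous_real continuous_on_mult) (auto intro: continuous_on_subset)
    have es: "s u + a * integral {0..u} (\<lambda>\<tau>. frac_kernel \<rho> (u - \<tau>) * s \<tau>) = 1"
      and er: "r u + a * integral {0..u} (\<lambda>\<tau>. frac_kernel \<rho> (u - \<tau>) * r \<tau>) = 1"
      using s r u by (auto simp: solves_resolvent_eq_def)
    have "integral {0..u} (\<lambda>\<tau>. frac_kernel \<rho> (u - \<tau>) * ?d \<tau>) =
      integral {0..u} (\<lambda>\<tau>. frac_kernel \<rho> (u - \<tau>) * s \<tau>) - integral {0..u} (\<lambda>\<tau>. frac_kernel \<rho> (u - \<tau>) * r \<tau>)"
      unfolding right_diff_distrib by (intro integral_diff int c)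
    with es er have "?d u = - a * integral {0..u} (\<lambda>\<tau>. frac_kernel \<rho> (u - \<tau>) * ?d \<tau>)"
      by (simp add: algebra_simps(1-8) right_diff_distrib[of a])
    then have "\<bar>?d u\<bar> = \<bar>a\<bar> * \<bar>integral {0..u} (\<lambda>\<tau>. frac_kernel \<rho> (u - \<tau>) * ?d \<tau>)\<bar>"
      by (simp add: abs_mult)
    also have "\<bar>integral {0..u} (\<lambda>\<tau>. frac_kernel \<rho> (u - \<tau>) * ?d \<tau>)\<bar> \<le> integral {0..u} (\<lambda>\<tau>. frac_kernel \<rho> t * \<bar>?d \<tau>\<bar>)"
    proof (rule integral_norm_bound_integral[where 'a=real, unfolded real_norm_def])
      show "(\<lambda>\<tau>. frac_kernel \<rho> (u - \<tau>) * ?d \<tau>) integrable_on {0..u}"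
        using c by (intro int continuous_on_diff)
      show "(\<lambda>\<tau>. frac_kernel \<rho> t * \<bar>?d \<tau>\<bar>) integrable_on {0..u}"
        by (intro integrable_continuous_real continuous_intros cd)
      show "\<bar>frac_kernel \<rho> (u - \<tau>) * ?d \<tau>\<bar> \<le> frac_kernel \<rho> t * \<bar>?d \<tau>\<bar>" if "\<tau> \<in> {0..u}" for \<tau>
        using frac_kernel_bound[OF \<open>1 < \<rho>\<close> that, of t] u by (auto simp: abs_mult intro!: mult_right_mono)
    qed
    finally show "\<bar>?d u\<bar> \<le> \<bar>a\<bar> * frac_kernel \<rho> t * integral {0..u} (\<lambda>\<tau>. \<bar>?d \<tau>\<bar>)"
      by (simp add: mult.assoc mult_left_mono)
  qed (use \<open>0 \<le> t\<close> in auto)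
  then show ?thesis by simp
qed

lemma scalar_resolvent_eq_frac_series:
  assumes "1 < \<rho>" "0 \<le> t"
  shows "scalar_resolvent \<rho> a t = frac_series \<rho> (\<lambda>k. a ^ k) t"
  unfolding scalar_resolvent_def
proof (rule the_equality)
  show "\<exists>s. solves_resolvent_eq \<rho> a s \<and> frac_series \<rho> (\<lambda>k. a ^ k) t = s t"
    using frac_series_solves_resolvent_eq[OF assms(1)] by blast
  show "y = frac_series \<rho> (\<lambda>k. a ^ k) t" if "\<exists>s. solves_resolvent_eq \<rho> a s \<and> y = s t" for y
    using that solves_resolvent_eq_unique[OF assms(1) _ frac_series_solves_resolvent_eq[OF assms(1)] assms(2)] by blast
qed

section \<open>Gamma moments\<close>

lemma nn_integral_powr_exp:
  fixes s b :: real
  assumes s: "0 < s" and b: "0 < b"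
  shows "(\<integral>\<^sup>+x. ennreal (indicator {0<..} x * (x powr (s - 1) * exp (- b * x))) \<partial>lborel) = ennreal (Gamma s / b powr s)"
    (is "?I = _")
proof -
  have "ennreal (Gamma s) = (\<integral>\<^sup>+x. ennreal (indicator {0..} x * x powr (s - 1) / exp x) \<partial>lborel)"
    by (rule Gamma_conv_nn_integral_real[OF s])
  also have "\<dots> = ennreal b * (\<integral>\<^sup>+x. ennreal (indicator {0..} (b * x) * (b * x) powr (s - 1) / exp (b * x)) \<partial>lborel)"
    using b by (subst nn_integral_real_affine[where c=b and t=0]) auto
  also have "(\<lambda>x. ennreal (indicator {0..} (b * x) * (b * x) powr (s - 1) / exp (b * x))) =
      (\<lambda>x. ennreal (b powr (s - 1)) * ennreal (indicator {0<..} x * (x powr (s - 1) * exp (- b * x))))"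
  proof
    fix x
    show "ennreal (indicator {0..} (b * x) * (b * x) powr (s - 1) / exp (b * x)) =
      ennreal (b powr (s - 1)) * ennreal (indicator {0<..} x * (x powr (s - 1) * exp (- b * x)))"
      using b by (cases "x = 0"; cases "0 < x")
        (simp_all add: indicator_def zero_le_mult_iff powr_mult exp_minus divide_inverse ennreal_mult'[symmetric] mult.assoc)
  qed
  also have "ennreal b * (\<integral>\<^sup>+x. ennreal (b powr (s - 1)) * ennreal (indicator {0<..} x * (x powr (s - 1) * exp (- b * x))) \<partial>lborel)
     = (ennreal b * ennreal (b powr (s - 1))) * ?I"
    by (subst nn_integral_cmult) (measurable, simp only: mult.assoc)
  also have "ennreal b * ennreal (b powr (s - 1)) = ennreal (b powr s)"
    using b powr_mult_base[of b "s - 1"] by (subst ennreal_mult[symmetric]) auto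
  finally have "ennreal (inverse (b powr s)) * ennreal (Gamma s) =
      (ennreal (inverse (b powr s)) * ennreal (b powr s)) * ?I"
    by (simp only: mult.assoc)
  also have "ennreal (inverse (b powr s)) * ennreal (b powr s) = 1"
    using b by (subst ennreal_mult[symmetric]) auto
  finally show ?thesis
    using b by (simp add: ennreal_mult''[symmetric] divide_inverse mult.commute)
qed

context prob_space
begin

lemma gamma_distributed_AE_pos:
  assumes "distributed M lborel X (\<lambda>x. ennreal (gamma_density \<mu> lam x))"
  shows "AE \<omega> in M. 0 < X \<omega>"
  by (subst distributed_AE2[OF assms]) (auto simp: gamma_density_def)

text \<open>The factor \<open>exp (c * x)\<close> turns the density into an unnormalized Gamma
  density of rate \<open>lam - c\<close>, and \<open>x^j\<close> raises its shape to
  \<open>\<mu> + j\<close>. One formula thus gives the moments (\<open>c = 0\<close>) and the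
  exponential moments (\<open>j = 0\<close>).\<close>

lemma gamma_distributed_exp_moment:
  assumes D: "distributed M lborel X (\<lambda>x. ennreal (gamma_density \<mu> lam x))"
    and pos: "0 < \<mu>" "0 < lam" and c: "c < lam"
  shows "has_bochner_integral M (\<lambda>\<omega>. X \<omega> ^ j * exp (c * X \<omega>))
    (lam powr \<mu> / Gamma \<mu> * (Gamma (\<mu> + real j) / (lam - c) powr (\<mu> + real j)))"
proof -
  let ?r = "lam powr \<mu> / Gamma \<mu> * (Gamma (\<mu> + real j) / (lam - c) powr (\<mu> + real j))"
  have G: "Gamma \<mu> > 0" "Gamma (\<mu> + real j) > 0" using pos by (auto intro!: Gamma_real_pos)
  have X[measurable]: "X \<in> borel_measurable M"
    using distributed_measurable[OF D] by simp
  have "(\<integral>\<^sup>+\<omega>. ennreal (X \<omega> ^ j * exp (c * X \<omega>)) \<partial>M) =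
     (\<integral>\<^sup>+x. ennreal (gamma_density \<mu> lam x) * ennreal (x ^ j * exp (c * x)) \<partial>lborel)"
    by (rule distributed_nn_integral[OF D, symmetric]) measurable
  also have "\<dots> = (\<integral>\<^sup>+x. ennreal (lam powr \<mu> / Gamma \<mu>) * ennreal (indicator {0<..} x *
      (x powr (\<mu> + real j - 1) * exp (- (lam - c) * x))) \<partial>lborel)"
  proof (intro nn_integral_cong)
    fix x :: real
    show "ennreal (gamma_density \<mu> lam x) * ennreal (x ^ j * exp (c * x)) =
      ennreal (lam powr \<mu> / Gamma \<mu>) * ennreal (indicator {0<..} x * (x powr (\<mu> + real j - 1) * exp (- (lam - c) * x)))"
    proof (cases "0 < x")
      case True
      have "lam * lam powr (\<mu> - 1) = lam powr \<mu>"
        using pos powr_mult_base[of lam "\<mu> - 1"] by simp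
      moreover have "x powr (\<mu> - 1) * x ^ j = x powr (\<mu> + real j - 1)"
        using True by (simp add: powr_realpow[symmetric] powr_add[symmetric] algebra_simps)
      moreover have "exp (- lam * x) * exp (c * x) = exp (- (lam - c) * x)"
        by (simp add: exp_add[symmetric] algebra_simps)
      moreover have "gamma_density \<mu> lam x * (x ^ j * exp (c * x)) =
          1 / Gamma \<mu> * (lam * lam powr (\<mu> - 1)) * (x powr (\<mu> - 1) * x ^ j) * (exp (- lam * x) * exp (c * x))"
        using True pos by (simp add: gamma_density_def powr_mult)
      ultimately have "gamma_density \<mu> lam x * (x ^ j * exp (c * x)) =
         lam powr \<mu> / Gamma \<mu> * (x powr (\<mu> + real j - 1) * exp (- (lam - c) * x))"
        by simp
      moreover have "ennreal (gamma_density \<mu> lam x) * ennreal (x ^ j * exp (c * x)) =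
          ennreal (gamma_density \<mu> lam x * (x ^ j * exp (c * x)))"
        using True by (intro ennreal_mult''[symmetric]) simp
      moreover have "ennreal (lam powr \<mu> / Gamma \<mu>) * ennreal (x powr (\<mu> + real j - 1) * exp (- (lam - c) * x)) =
          ennreal (lam powr \<mu> / Gamma \<mu> * (x powr (\<mu> + real j - 1) * exp (- (lam - c) * x)))"
        by (intro ennreal_mult''[symmetric]) simp
      ultimately show ?thesis using True by (simp only: indicator_simps greaterThan_iff mult_1)
    qed (simp add: gamma_density_def)
  qed
  also have "\<dots> = ennreal (lam powr \<mu> / Gamma \<mu>) * (\<integral>\<^sup>+x. ennreal (indicator {0<..} x *
      (x powr (\<mu> + real j - 1) * exp (- (lam - c) * x))) \<partial>lborel)"
    by (rule nn_integral_cmult) measurable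
  also have "(\<integral>\<^sup>+x. ennreal (indicator {0<..} x * (x powr (\<mu> + real j - 1) * exp (- (lam - c) * x))) \<partial>lborel) =
      ennreal (Gamma (\<mu> + real j) / (lam - c) powr (\<mu> + real j))"
    using c pos by (intro nn_integral_powr_exp) auto
  also have "ennreal (lam powr \<mu> / Gamma \<mu>) * \<dots> = ennreal ?r"
    using G by (intro ennreal_mult[symmetric]) auto
  finally have e: "(\<integral>\<^sup>+\<omega>. ennreal (X \<omega> ^ j * exp (c * X \<omega>)) \<partial>M) = ennreal ?r" .
  have "AE \<omega> in M. 0 \<le> X \<omega> ^ j * exp (c * X \<omega>)"
    using gamma_distributed_AE_pos[OF D] by eventually_elim simp
  moreover have "0 \<le> ?r" using G by simp
  ultimately show ?thesis
    using e by (subst (asm) nn_integral_eq_integrable) (auto simp: has_bochner_integral_iff)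
qed

lemma gamma_distributed_moment:
  assumes D: "distributed M lborel X (\<lambda>x. ennreal (gamma_density \<mu> lam x))"
    and pos: "0 < \<mu>" "0 < lam"
  shows "has_bochner_integral M (\<lambda>\<omega>. X \<omega> ^ j) (pochhammer \<mu> j / lam ^ j)"
proof -
  have "\<mu> \<notin> \<int>\<^sub>\<le>\<^sub>0" using pos by (auto elim!: nonpos_Ints_cases)
  then have "pochhammer \<mu> j = Gamma (\<mu> + real j) / Gamma \<mu>" by (rule pochhammer_Gamma)
  moreover have "(lam - 0) powr (\<mu> + real j) = lam powr \<mu> * lam ^ j"
    using pos by (simp add: powr_add powr_realpow)
  ultimately have "lam powr \<mu> / Gamma \<mu> * (Gamma (\<mu> + real j) / (lam - 0) powr (\<mu> + real j)) = pochhammer \<mu> j / lam ^ j"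
    using pos by simp
  moreover have "(\<lambda>\<omega>. X \<omega> ^ j * exp (0 * X \<omega>)) = (\<lambda>\<omega>. X \<omega> ^ j)" by simp
  ultimately show ?thesis using gamma_distributed_exp_moment[OF D pos, of 0 j] pos by (simp only:)
qed

text \<open>The terms are almost surely nonnegative with partial sums below
  \<open>exp (d * X)\<close>, which justifies exchanging sum and expectation. In the application the
  weighted limit moments thereby add up to the limit of the empirical exponential means.\<close>

lemma exp_moment_sums:
  fixes X :: "'a \<Rightarrow> real"
  assumes [measurable]: "X \<in> borel_measurable M" and nonneg: "AE \<omega> in M. 0 \<le> X \<omega>" and d: "0 \<le> d"
    and int: "\<And>j. integrable M (\<lambda>\<omega>. X \<omega> ^ j)" and inte: "integrable M (\<lambda>\<omega>. exp (d * X \<omega>))"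
  shows "(\<lambda>j. d ^ j / fact j * expectation (\<lambda>\<omega>. X \<omega> ^ j)) sums expectation (\<lambda>\<omega>. exp (d * X \<omega>))"
proof -
  define f where "f j \<omega> = d ^ j / fact j * X \<omega> ^ j" for j \<omega>
  have fs: "(\<lambda>j. f j \<omega>) sums exp (d * X \<omega>)" for \<omega>
  proof -
    have "(d * X \<omega>) ^ j /\<^sub>R fact j = f j \<omega>" for j
      by (simp add: f_def power_mult_distrib real_scaleR_def inverse_eq_divide)
    then show ?thesis using exp_converges[of "d * X \<omega>"] by (simp only:)
  qed
  have fi: "integrable M (f j)" for j
    unfolding f_def[abs_def] by (intro integrable_mult_right int)
  have fn: "AE \<omega> in M. 0 \<le> f j \<omega>" for j
    using nonneg by eventually_elim (use d in \<open>simp add: f_def\<close>)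
  have norm: "(\<integral>\<omega>. norm (f j \<omega>) \<partial>M) = expectation (f j)" for j
    using fn[of j] fi by (intro integral_cong_AE) auto
  have "summable (\<lambda>j. expectation (f j))"
  proof (rule bounded_imp_summable)
    show "0 \<le> expectation (f j)" for j using fn by (rule integral_nonneg_AE)
    fix n
    have "(\<Sum>j\<le>n. expectation (f j)) = expectation (\<lambda>\<omega>. \<Sum>j\<le>n. f j \<omega>)"
      using fi by simp
    also have "\<dots> \<le> expectation (\<lambda>\<omega>. exp (d * X \<omega>))"
    proof (rule integral_mono_AE)
      show "AE \<omega> in M. (\<Sum>j\<le>n. f j \<omega>) \<le> exp (d * X \<omega>)"
        using nonneg
      proof eventually_elim
        case (elim \<omega>)
        then have "0 \<le> f j \<omega>" for j using d by (simp add: f_def)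
        then show ?case using fs[of \<omega>] sum_le_suminf[of "\<lambda>j. f j \<omega>" "{..n}"] by (auto simp: sums_iff)
      qed
    qed (use fi inte in auto)
    finally show "(\<Sum>j\<le>n. expectation (f j)) \<le> expectation (\<lambda>\<omega>. exp (d * X \<omega>))" .
  qed
  then have "(\<lambda>j. expectation (f j)) sums (\<integral>\<omega>. (\<Sum>j. f j \<omega>) \<partial>M)"
  proof (intro sums_integral fi)
    show "AE \<omega> in M. summable (\<lambda>j. norm (f j \<omega>))"
      using nonneg
    proof eventually_elim
      case (elim \<omega>)
      then have "norm (f j \<omega>) = f j \<omega>" for j using d by (simp add: f_def)
      then show ?case using fs[of \<omega>] by (simp add: sums_iff)
    qed
  qed (simp only: norm)
  moreover have "(\<integral>\<omega>. (\<Sum>j. f j \<omega>) \<partial>M) = expectation (\<lambda>\<omega>. exp (d * X \<omega>))"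
    using fs by (simp add: sums_iff)
  moreover have "expectation (f j) = d ^ j / fact j * expectation (\<lambda>\<omega>. X \<omega> ^ j)" for j
    unfolding f_def[abs_def] by (rule integral_mult_right_zero)
  ultimately show ?thesis by (simp only:)
qed

end

section \<open>Convergence of the weighted empirical moments\<close>

text \<open>Termwise convergence alone would let mass escape to large \<open>j\<close>; convergence
  of the totals \<open>s n\<close> excludes this. Sums in \<open>ennreal\<close> make the distance
  meaningful before its summability is known.\<close>

lemma Scheffe_series:
  fixes x :: "nat \<Rightarrow> nat \<Rightarrow> real"
  assumes nonneg: "\<And>n j. 0 \<le> x n j" and lim: "\<And>j. (\<lambda>n. x n j) \<longlonglongrightarrow> y j"
    and xs: "\<And>n. x n sums s n" and ys: "y sums S" and s: "s \<longlonglongrightarrow> S"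
  shows "(\<lambda>n. \<Sum>j. ennreal \<bar>x n j - y j\<bar>) \<longlonglongrightarrow> 0"
proof -
  have y: "0 \<le> y j" for j
    using LIMSEQ_le_const[OF lim[of j]] nonneg by blast
  have S: "(\<Sum>j. ennreal (y j)) = ennreal S"
    using suminf_ennreal_eq[OF y ys] .
  have sn: "(\<Sum>j. ennreal (x n j)) = ennreal (s n)" for n
    using suminf_ennreal_eq[OF nonneg xs] .
  have abs: "\<bar>x n j\<bar> = x n j" "\<bar>y j\<bar> = y j" for n j
    using nonneg y by simp_all
  have "limsup (\<lambda>n. ennreal (s n)) = ennreal S"
    using tendsto_ennrealI[OF s] by (intro lim_imp_Limsup) simp_all
  then have "limsup (\<lambda>n. \<integral>\<^sup>+ j. norm (x n j) \<partial>count_space UNIV) \<le> (\<integral>\<^sup>+ j. norm (y j) \<partial>count_space UNIV)"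
    by (simp add: nn_integral_count_space_nat abs S sn)
  moreover have "integrable (count_space UNIV) (x n)" "integrable (count_space UNIV) y" for n
    using sums_summable[OF xs] sums_summable[OF ys] by (simp_all add: integrable_count_space_nat_iff abs)
  ultimately have "(\<lambda>n. \<integral>\<^sup>+ j. norm (x n j - y j) \<partial>count_space UNIV) \<longlonglongrightarrow> 0"
    using lim by (intro Scheffe_lemma1) simp_all
  then show ?thesis by (simp add: nn_integral_count_space_nat)
qed

text \<open>The factor 2 in \<open>2 * d < lam\<close> gives \<open>exp (d * \<alpha> k)\<close> a
  finite second moment, as the strong law demands. There are only countably many exceptional sets,
  so a single null set serves all \<open>j\<close>.\<close>

lemma (in prob_space) gamma_empirical_moments_converge:
  fixes \<alpha> :: "nat \<Rightarrow> 'a \<Rightarrow> real"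
  assumes pos: "0 < \<mu>" "0 < lam" and indep: "indep_vars (\<lambda>_. borel) \<alpha> {1..}"
    and D: "\<And>k. 1 \<le> k \<Longrightarrow> distributed M lborel (\<alpha> k) (\<lambda>x. ennreal (gamma_density \<mu> lam x))"
    and d: "0 < d" "2 * d < lam"
  shows "AE \<omega> in M. (\<lambda>n. \<Sum>j. ennreal (d ^ j / fact j *
      \<bar>(\<Sum>k=1..n. \<alpha> k \<omega> ^ j) / real n - pochhammer \<mu> j / lam ^ j\<bar>)) \<longlonglongrightarrow> 0"
    and "summable (\<lambda>j. d ^ j / fact j * (pochhammer \<mu> j / lam ^ j))"
proof -
  define m where "m j = pochhammer \<mu> j / lam ^ j" for j
  have pos1: "AE \<omega> in M. 0 \<le> \<alpha> k \<omega>" if "1 \<le> k" for k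
    using gamma_distributed_AE_pos[OF D[OF that]] by eventually_elim simp
  note mom = gamma_distributed_moment[OF D pos, folded m_def]
  have "AE \<omega> in M. (\<lambda>n. (\<Sum>k=1..n. \<alpha> k \<omega> ^ j) / real n) \<longlonglongrightarrow> m j" for j
  proof (rule strong_law_nonneg[where q="m (2 * j)"])
    show "indep_vars (\<lambda>_. borel) (\<lambda>k \<omega>. \<alpha> k \<omega> ^ j) {1..}"
      by (rule indep_vars_compose2[OF indep]) measurable
    have "(x ^ j)\<^sup>2 = x ^ (2 * j)" for x :: real by (simp add: power_mult[symmetric] mult.commute)
    then show "integrable M (\<lambda>\<omega>. (\<alpha> k \<omega> ^ j)\<^sup>2)" "expectation (\<lambda>\<omega>. (\<alpha> k \<omega> ^ j)\<^sup>2) = m (2 * j)" if "1 \<le> k" for k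
      using mom[OF that, of "2 * j"] by (simp_all add: has_bochner_integral_iff)
    show "expectation (\<lambda>\<omega>. \<alpha> k \<omega> ^ j) = m j" if "1 \<le> k" for k
      using mom[OF that, of j] by (simp add: has_bochner_integral_iff)
    show "AE \<omega> in M. 0 \<le> \<alpha> k \<omega> ^ j" if "1 \<le> k" for k
      using pos1[OF that] by eventually_elim simp
  qed
  then have AE1: "AE \<omega> in M. \<forall>j. (\<lambda>n. (\<Sum>k=1..n. \<alpha> k \<omega> ^ j) / real n) \<longlonglongrightarrow> m j"
    by (simp add: AE_all_countable)
  define E where "E c = lam powr \<mu> / Gamma \<mu> * (Gamma (\<mu> + real 0) / (lam - c) powr (\<mu> + real 0))" for c
  have expm: "has_bochner_integral M (\<lambda>\<omega>. exp (c * \<alpha> k \<omega>)) (E c)" if "1 \<le> k" "c < lam" for c k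
    using gamma_distributed_exp_moment[OF D[OF that(1)] pos that(2), of 0] unfolding E_def by simp
  have d': "d < lam" using d by linarith
  have AE2: "AE \<omega> in M. (\<lambda>n. (\<Sum>k=1..n. exp (d * \<alpha> k \<omega>)) / real n) \<longlonglongrightarrow> E d"
  proof (rule strong_law_nonneg[where q="E (2 * d)"])
    show "indep_vars (\<lambda>_. borel) (\<lambda>k \<omega>. exp (d * \<alpha> k \<omega>)) {1..}"
      by (rule indep_vars_compose2[OF indep]) measurable
    have "(exp (d * x))\<^sup>2 = exp (2 * d * x)" for x by (simp add: exp_double[symmetric] mult.assoc)
    then show "integrable M (\<lambda>\<omega>. (exp (d * \<alpha> k \<omega>))\<^sup>2)" "expectation (\<lambda>\<omega>. (exp (d * \<alpha> k \<omega>))\<^sup>2) = E (2 * d)"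
      if "1 \<le> k" for k
      using expm[OF that, of "2 * d"] d by (simp_all add: has_bochner_integral_iff)
    show "expectation (\<lambda>\<omega>. exp (d * \<alpha> k \<omega>)) = E d" if "1 \<le> k" for k
      using expm[OF that d'] by (simp add: has_bochner_integral_iff)
  qed simp
  have ms: "(\<lambda>j. d ^ j / fact j * m j) sums E d"
  proof -
    have "(\<lambda>j. d ^ j / fact j * expectation (\<lambda>\<omega>. \<alpha> 1 \<omega> ^ j)) sums expectation (\<lambda>\<omega>. exp (d * \<alpha> 1 \<omega>))"
    proof (rule exp_moment_sums)
      show "\<alpha> 1 \<in> borel_measurable M" using distributed_measurable[OF D[of 1]] by simp
      show "integrable M (\<lambda>\<omega>. \<alpha> 1 \<omega> ^ j)" for j using mom[of 1 j] by (simp add: has_bochner_integral_iff)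
      show "integrable M (\<lambda>\<omega>. exp (d * \<alpha> 1 \<omega>))" using expm[of 1 d] d' by (simp add: has_bochner_integral_iff)
    qed (use pos1[of 1] d in auto)
    then show ?thesis
      using has_bochner_integral_integral_eq[OF mom[of 1]] has_bochner_integral_integral_eq[OF expm[of 1 d]] d'
      by simp
  qed
  then show "summable (\<lambda>j. d ^ j / fact j * (pochhammer \<mu> j / lam ^ j))"
    by (simp add: sums_iff m_def)
  have AE3: "AE \<omega> in M. \<forall>k\<in>{1..}. 0 \<le> \<alpha> k \<omega>"
    using pos1 by (subst AE_ball_countable) auto
  show "AE \<omega> in M. (\<lambda>n. \<Sum>j. ennreal (d ^ j / fact j *
      \<bar>(\<Sum>k=1..n. \<alpha> k \<omega> ^ j) / real n - pochhammer \<mu> j / lam ^ j\<bar>)) \<longlonglongrightarrow> 0"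
    using AE1 AE2 AE3
  proof eventually_elim
    case (elim \<omega>)
    have "(\<lambda>n. \<Sum>j. ennreal \<bar>d ^ j / fact j * ((\<Sum>k=1..n. \<alpha> k \<omega> ^ j) / real n) - d ^ j / fact j * m j\<bar>) \<longlonglongrightarrow> 0"
    proof (rule Scheffe_series[OF _ _ _ ms elim(2)])
      show "0 \<le> d ^ j / fact j * ((\<Sum>k=1..n. \<alpha> k \<omega> ^ j) / real n)" for n j
        using elim(3) d by (auto intro!: mult_nonneg_nonneg divide_nonneg_nonneg sum_nonneg)
      show "(\<lambda>n. d ^ j / fact j * ((\<Sum>k=1..n. \<alpha> k \<omega> ^ j) / real n)) \<longlonglongrightarrow> d ^ j / fact j * m j" for j
        using elim(1) by (intro tendsto_mult_left) auto
      fix n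
      \<comment> \<open>Averaging the exponential series of the \<open>n\<close> variables
        identifies the total of the weighted empirical moments.\<close>
      have "(\<lambda>j. (\<Sum>k=1..n. (d * \<alpha> k \<omega>) ^ j /\<^sub>R fact j) / real n) sums ((\<Sum>k=1..n. exp (d * \<alpha> k \<omega>)) / real n)"
        by (intro sums_divide sums_sum exp_converges)
      moreover have "(d * x) ^ j /\<^sub>R fact j = d ^ j / fact j * x ^ j" for x j
        by (simp add: power_mult_distrib real_scaleR_def inverse_eq_divide)
      ultimately show "(\<lambda>j. d ^ j / fact j * ((\<Sum>k=1..n. \<alpha> k \<omega> ^ j) / real n)) sums ((\<Sum>k=1..n. exp (d * \<alpha> k \<omega>)) / real n)"
        by (simp only: sum_distrib_left times_divide_eq_right)
    qed
    moreover have "\<bar>d ^ j / fact j * A - d ^ j / fact j * m j\<bar> = d ^ j / fact j * \<bar>A - m j\<bar>" for A j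
      using d unfolding right_diff_distrib[symmetric] abs_mult by simp
    ultimately show ?case by (simp only: m_def)
  qed
qed

section \<open>Wiener integrals of step functions\<close>

text \<open>\<open>min s t\<close> is also the covariance of Brownian motion at the times
  \<open>s\<close> and \<open>t\<close>; this coincidence is what makes the isometry below
  work.\<close>

lemma has_bochner_integral_indicator_Ioc_mult:
  fixes s t :: real
  assumes "0 \<le> s" "0 \<le> t"
  shows "has_bochner_integral lborel (\<lambda>x. indicator {0<..s} x * indicator {0<..t} x :: real) (min s t)"
proof -
  have "has_bochner_integral lborel (indicator {0<..min s t}) (measure lborel {0<..min s t})"
    using assms by (intro has_bochner_integral_real_indicator) auto
  moreover have "(indicator {0<..min s t} :: real \<Rightarrow> real) = (\<lambda>x. indicator {0<..s} x * indicator {0<..t} x)"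
    by (auto simp: fun_eq_iff indicator_def)
  ultimately show ?thesis using assms by simp
qed

lemma indicator_Ioc_diff:
  fixes a b x :: real
  assumes "0 \<le> a" "a \<le> b"
  shows "(indicator {a<..b} x :: real) = indicator {0<..b} x - indicator {0<..a} x"
  using assms by (auto simp: indicator_def)

lemma has_bochner_integral_square_sum:
  fixes f :: "'i \<Rightarrow> 'a \<Rightarrow> real"
  assumes "\<And>i j. i \<in> I \<Longrightarrow> j \<in> I \<Longrightarrow> has_bochner_integral M (\<lambda>x. f i x * f j x) (r i j)"
  shows "has_bochner_integral M (\<lambda>x. (\<Sum>i\<in>I. c i * f i x)\<^sup>2) (\<Sum>i\<in>I. \<Sum>j\<in>I. c i * c j * r i j)"
proof -
  have "(\<Sum>i\<in>I. c i * f i x)\<^sup>2 = (\<Sum>i\<in>I. \<Sum>j\<in>I. c i * c j * (f i x * f j x))" for x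
    unfolding power2_eq_square sum_product by (intro sum.cong refl) (simp only: mult_ac)
  then show ?thesis
    using assms by (simp only:) (intro has_bochner_integral_sum has_bochner_integral_mult_right)
qed

text \<open>Stated for an abstract family so that it applies both to \<open>W t - W 0\<close> and to
  the indicator of \<open>{0<..t}\<close>: the common inner products \<open>min s t\<close> force
  common inner products of increments.\<close>

lemma has_bochner_integral_bilinear_diff:
  fixes F G :: "real \<Rightarrow> 'a \<Rightarrow> real"
  assumes "\<And>s t. 0 \<le> s \<Longrightarrow> 0 \<le> t \<Longrightarrow> has_bochner_integral M (\<lambda>x. F s x * F t x) (min s t)"
    and "0 \<le> a" "0 \<le> b" "0 \<le> c" "0 \<le> d"
  shows "has_bochner_integral M (\<lambda>x. (F b x - F a x) * (F d x - F c x)) (min b d - min b c - (min a d - min a c))"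
proof -
  have "has_bochner_integral M (\<lambda>x. F b x * F d x - F b x * F c x - (F a x * F d x - F a x * F c x))
     (min b d - min b c - (min a d - min a c))"
    using assms by (intro has_bochner_integral_diff) auto
  then show ?thesis by (simp add: algebra_simps)
qed

text \<open>Replaces the triangle inequality in \<open>L^2\<close>, so that the estimates stay
  inside nonnegative integrals and raise no integrability questions.\<close>

lemma ennreal_square_diff_le:
  fixes x y z :: real
  shows "ennreal ((x - z)\<^sup>2) \<le> 2 * ennreal ((x - y)\<^sup>2) + 2 * ennreal ((y - z)\<^sup>2)"
proof -
  have "(x - z)\<^sup>2 \<le> 2 * (x - y)\<^sup>2 + 2 * (y - z)\<^sup>2"
    using sum_squares_bound[of "x - y" "y - z"] by (simp add: power2_eq_square algebra_simps)
  then have "ennreal ((x - z)\<^sup>2) \<le> ennreal (2 * (x - y)\<^sup>2 + 2 * (y - z)\<^sup>2)" by (rule ennreal_leI)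
  also have "\<dots> = 2 * ennreal ((x - y)\<^sup>2) + 2 * ennreal ((y - z)\<^sup>2)"
    by (simp add: ennreal_plus ennreal_mult')
  finally show ?thesis .
qed

lemma is_partition_bounds:
  assumes "is_partition t n p" "i \<le> n"
  shows "0 \<le> p i" "p i \<le> t"
proof -
  have m: "p i \<le> p j" if "i \<le> j" "j \<le> n" for i j
    using that
  proof (induction j)
    case (Suc j)
    then show ?case using assms(1) by (cases "i = Suc j") (auto simp: is_partition_def intro: order_trans)
  qed simp
  show "0 \<le> p i" "p i \<le> t" using m[of 0 i] m[of i n] assms by (auto simp: is_partition_def)
qed

lemma step_fun_eq_0:
  assumes p: "is_partition t n p" and \<tau>: "\<tau> \<notin> {0..t}"
  shows "step_fun n p c \<tau> = 0"
  unfolding step_fun_def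
proof (intro sum.neutral ballI)
  fix i assume i: "i \<in> {..<n}"
  then have "0 \<le> p i" "p (Suc i) \<le> t" using is_partition_bounds[OF p] by auto
  then show "c i * indicator {p i<..p (Suc i)} \<tau> = 0" using \<tau> by (auto simp: indicator_def)
qed

section \<open>Covariance of Brownian motion and the isometry for step functions\<close>

context standard_brownian_motion
begin

lemma increment_moments:
  assumes "0 \<le> s" "s \<le> t"
  shows "has_bochner_integral M (\<lambda>\<omega>. W t \<omega> - W s \<omega>) 0"
    and "has_bochner_integral M (\<lambda>\<omega>. (W t \<omega> - W s \<omega>)\<^sup>2) (t - s)"
proof -
  have "has_bochner_integral M (\<lambda>\<omega>. W t \<omega> - W s \<omega>) 0 \<and> has_bochner_integral M (\<lambda>\<omega>. (W t \<omega> - W s \<omega>)\<^sup>2) (t - s)"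
  \<comment> \<open>The law of an increment is specified only for \<open>s < t\<close>; for equal
    times the increment is 0.\<close>
  proof (cases "s = t")
    case False
    with assms have st: "s < t" by simp
    let ?\<sigma> = "sqrt (t - s)"
    let ?X = "\<lambda>\<omega>. W t \<omega> - W s \<omega>"
    have \<sigma>: "0 < ?\<sigma>" using st by simp
    note D = normal_increments[OF assms(1) st]
    have "integrable M ?X"
      using integrable_normal_moment_nz_1[OF \<sigma>, of 0]
      by (subst distributed_integrable[OF D, symmetric]) auto
    moreover have "integrable M (\<lambda>\<omega>. (?X \<omega>)\<^sup>2)"
      using integrable_normal_moment[OF \<sigma>, of 0 2]
      by (subst distributed_integrable[OF D, symmetric]) auto
    moreover have "expectation ?X = 0" by (rule normal_distributed_expectation[OF \<sigma> D])
    moreover have "variance ?X = t - s"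
      using normal_distributed_variance[OF \<sigma> D] st by simp
    ultimately show ?thesis by (simp add: has_bochner_integral_iff)
  qed (simp add: has_bochner_integral_zero)
  then show "has_bochner_integral M (\<lambda>\<omega>. W t \<omega> - W s \<omega>) 0"
    and "has_bochner_integral M (\<lambda>\<omega>. (W t \<omega> - W s \<omega>)\<^sup>2) (t - s)" by auto
qed

text \<open>For \<open>s \<le> t\<close> the increment \<open>W t - W 0\<close> splits into
  \<open>W s - W 0\<close> and an independent centered increment, which leaves the variance
  \<open>s\<close>. Subtracting \<open>W 0\<close> avoids the null set where it is not 0.\<close>

lemma covariance:
  assumes "0 \<le> s" "0 \<le> t"
  shows "has_bochner_integral M (\<lambda>\<omega>. (W s \<omega> - W 0 \<omega>) * (W t \<omega> - W 0 \<omega>)) (min s t)"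
proof -
  have *: "has_bochner_integral M (\<lambda>\<omega>. (W s \<omega> - W 0 \<omega>) * (W t \<omega> - W 0 \<omega>)) s" if st: "0 \<le> s" "s \<le> t" for s t
  proof -
    define p where "p i = (if i = 0 then 0 else if i = 1 then s else t)" for i :: nat
    have "indep_vars (\<lambda>_. borel) (\<lambda>i \<omega>. W (p (Suc i)) \<omega> - W (p i) \<omega>) {..<2}"
      using st by (intro indep_increments) (auto simp: p_def less_2_cases_iff)
    moreover have "integrable M (\<lambda>\<omega>. W (p (Suc i)) \<omega> - W (p i) \<omega>)" for i
      using st increment_moments(1)[of "p i" "p (Suc i)"] by (auto simp: p_def has_bochner_integral_iff)
    ultimately have
      "expectation (\<lambda>\<omega>. \<Prod>i<2. W (p (Suc i)) \<omega> - W (p i) \<omega>) = (\<Prod>i<2. expectation (\<lambda>\<omega>. W (p (Suc i)) \<omega> - W (p i) \<omega>))"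
      "integrable M (\<lambda>\<omega>. \<Prod>i<2. W (p (Suc i)) \<omega> - W (p i) \<omega>)"
      by (intro indep_vars_lebesgue_integral indep_vars_integrable; simp)+
    then have "has_bochner_integral M (\<lambda>\<omega>. (W s \<omega> - W 0 \<omega>) * (W t \<omega> - W s \<omega>)) 0"
      using increment_moments(1)[of 0 s] st
      by (simp add: has_bochner_integral_iff numeral_2_eq_2 p_def)
    then have "has_bochner_integral M (\<lambda>\<omega>. (W s \<omega> - W 0 \<omega>)\<^sup>2 + (W s \<omega> - W 0 \<omega>) * (W t \<omega> - W s \<omega>)) (s - 0 + 0)"
      using increment_moments(2)[of 0 s] st by (intro has_bochner_integral_add) auto
    then show ?thesis by (simp add: power2_eq_square algebra_simps)
  qed
  show ?thesis
    using *[of s t] *[of t s] assms by (cases "s \<le> t") (auto simp: min_def mult.commute)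
qed

text \<open>Both sides are the same quadratic form in the coefficients \<open>c\<close>, by the
  common inner products \<open>r i j\<close>. The intervals may overlap and carry no order, which
  the comparison of two partitions exploits.\<close>

lemma step_isometry:
  assumes ab: "\<And>i. i \<in> I \<Longrightarrow> 0 \<le> a i \<and> a i \<le> b i"
  shows "(\<integral>\<^sup>+\<omega>. ennreal ((\<Sum>i\<in>I. c i * (W (b i) \<omega> - W (a i) \<omega>))\<^sup>2) \<partial>M) =
    (\<integral>\<^sup>+\<tau>. ennreal ((\<Sum>i\<in>I. c i * indicator {a i<..b i} \<tau>)\<^sup>2) \<partial>lborel)"
proof -
  define r where "r i j = min (b i) (b j) - min (b i) (a j) - (min (a i) (b j) - min (a i) (a j))" for i j
  have 1: "has_bochner_integral M (\<lambda>\<omega>. (W (b i) \<omega> - W (a i) \<omega>) * (W (b j) \<omega> - W (a j) \<omega>)) (r i j)"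
    if "i \<in> I" "j \<in> I" for i j
    using has_bochner_integral_bilinear_diff[where F="\<lambda>t \<omega>. W t \<omega> - W 0 \<omega>" and a="a i" and b="b i" and c="a j" and d="b j",
        OF covariance] ab[OF that(1)] ab[OF that(2)]
    by (simp add: r_def)
  have 2: "has_bochner_integral lborel (\<lambda>\<tau>. indicator {a i<..b i} \<tau> * indicator {a j<..b j} \<tau> :: real) (r i j)"
    if "i \<in> I" "j \<in> I" for i j
    using has_bochner_integral_bilinear_diff[where F="\<lambda>t \<tau>. indicator {0<..t} \<tau>" and a="a i" and b="b i" and c="a j" and d="b j",
        OF has_bochner_integral_indicator_Ioc_mult] ab[OF that(1)] ab[OF that(2)]
    by (simp add: r_def indicator_Ioc_diff[of "a i" "b i"] indicator_Ioc_diff[of "a j" "b j"])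
  show ?thesis
    using has_bochner_integral_square_sum[of I M "\<lambda>i \<omega>. W (b i) \<omega> - W (a i) \<omega>" r c, OF 1]
      has_bochner_integral_square_sum[of I lborel "\<lambda>i \<tau>. indicator {a i<..b i} \<tau>" r c, OF 2]
    by (simp add: has_bochner_integral_iff nn_integral_eq_integral)
qed

lemma step_isometry_diff:
  assumes p: "is_partition t n p" and q: "is_partition t m q"
  shows "(\<integral>\<^sup>+\<omega>. ennreal ((step_integral W n p c \<omega> - step_integral W m q e \<omega>)\<^sup>2) \<partial>M) =
    (\<integral>\<^sup>+\<tau>\<in>{0..t}. ennreal ((step_fun n p c \<tau> - step_fun m q e \<tau>)\<^sup>2) \<partial>lborel)"
proof -
  \<comment> \<open>The disjoint union of both index sets, with the second coefficients negated,
    presents the difference as one family; no common refinement is formed.\<close>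
  let ?I = "{..<n} <+> {..<m}"
  let ?a = "case_sum p q" and ?b = "case_sum (\<lambda>i. p (Suc i)) (\<lambda>i. q (Suc i))" and ?c = "case_sum c (\<lambda>i. - e i)"
  have bd: "0 \<le> ?a i \<and> ?a i \<le> ?b i" if "i \<in> ?I" for i
    using that p q is_partition_bounds[OF p] is_partition_bounds[OF q]
    by (auto simp: is_partition_def less_imp_le)
  have W: "step_integral W n p c \<omega> - step_integral W m q e \<omega> = (\<Sum>i\<in>?I. ?c i * (W (?b i) \<omega> - W (?a i) \<omega>))" for \<omega>
    by (simp add: step_integral_def sum.Plus sum_negf[symmetric])
  have f: "step_fun n p c \<tau> - step_fun m q e \<tau> = (\<Sum>i\<in>?I. ?c i * indicator {?a i<..?b i} \<tau>)" for \<tau>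
    by (simp add: step_fun_def sum.Plus sum_negf del: sum_mult_indicator sum_indicator_mult)
  have "(\<integral>\<^sup>+\<omega>. ennreal ((step_integral W n p c \<omega> - step_integral W m q e \<omega>)\<^sup>2) \<partial>M) =
    (\<integral>\<^sup>+\<tau>. ennreal ((step_fun n p c \<tau> - step_fun m q e \<tau>)\<^sup>2) \<partial>lborel)"
    unfolding W f by (rule step_isometry[OF bd])
  also have "\<dots> = (\<integral>\<^sup>+\<tau>\<in>{0..t}. ennreal ((step_fun n p c \<tau> - step_fun m q e \<tau>)\<^sup>2) \<partial>lborel)"
    using step_fun_eq_0[OF p] step_fun_eq_0[OF q] by (intro nn_integral_cong) (auto simp: indicator_def)
  finally show ?thesis .
qed

lemma step_integral_measurable:
  assumes "is_partition t n p"
  shows "step_integral W n p c \<in> borel_measurable M"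
  unfolding step_integral_def[abs_def] using is_partition_bounds[OF assms]
  by (intro borel_measurable_sum borel_measurable_times borel_measurable_diff measurable_W) auto

text \<open>\<open>X\<close> comes with some unknown approximating sequence; this passes to any step
  function of choice. Going through the \<open>j\<close>-th approximation, the squared triangle
  inequality is applied under each of the two integrals, hence the factor 4, and the terms depending
  on \<open>j\<close> vanish in the limit.\<close>

lemma wiener_integral_step_distance:
  assumes X: "has_wiener_integral M W t f X" and q: "is_partition t m q"
  shows "(\<integral>\<^sup>+\<omega>. ennreal ((X \<omega> - step_integral W m q e \<omega>)\<^sup>2) \<partial>M) \<le>
    4 * (\<integral>\<^sup>+\<tau>\<in>{0..t}. ennreal ((f \<tau> - step_fun m q e \<tau>)\<^sup>2) \<partial>lborel)"
proof -
  from X obtain n p c where Xm[measurable]: "X \<in> borel_measurable M"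
    and fm: "set_borel_measurable lborel {0..t} f" and p: "\<And>j::nat. is_partition t (n j) (p j)"
    and l1: "(\<lambda>j. \<integral>\<^sup>+\<tau>\<in>{0..t}. ennreal ((f \<tau> - step_fun (n j) (p j) (c j) \<tau>)\<^sup>2) \<partial>lborel) \<longlonglongrightarrow> 0"
    and l2: "(\<lambda>j. \<integral>\<^sup>+\<omega>. ennreal ((X \<omega> - step_integral W (n j) (p j) (c j) \<omega>)\<^sup>2) \<partial>M) \<longlonglongrightarrow> 0"
    unfolding has_wiener_integral_def by blast
  let ?d = "\<integral>\<^sup>+\<tau>\<in>{0..t}. ennreal ((f \<tau> - step_fun m q e \<tau>)\<^sup>2) \<partial>lborel"
  let ?u = "\<lambda>j. \<integral>\<^sup>+\<tau>\<in>{0..t}. ennreal ((f \<tau> - step_fun (n j) (p j) (c j) \<tau>)\<^sup>2) \<partial>lborel"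
  let ?v = "\<lambda>j. \<integral>\<^sup>+\<omega>. ennreal ((X \<omega> - step_integral W (n j) (p j) (c j) \<omega>)\<^sup>2) \<partial>M"
  note [measurable] = step_integral_measurable[OF p] step_integral_measurable[OF q]
  have sm[measurable]: "step_fun k p c \<in> borel_measurable lborel" for k p c
    unfolding step_fun_def[abs_def] by measurable
  have fs: "(\<lambda>\<tau>. ennreal ((f \<tau> - step_fun k p c \<tau>)\<^sup>2) * indicator {0..t} \<tau>) \<in> borel_measurable lborel" for k p c
  proof -
    \<comment> \<open>Measurability of \<open>f\<close> is available only on \<open>{0..t}\<close>,
      so \<open>f\<close> is replaced by its product with the indicator.\<close>
    have [measurable]: "(\<lambda>\<tau>. indicator {0..t} \<tau> * f \<tau>) \<in> borel_measurable lborel"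
      using fm by (simp add: set_borel_measurable_def)
    have "(\<lambda>\<tau>. ennreal ((indicator {0..t} \<tau> * f \<tau> - step_fun k p c \<tau>)\<^sup>2) * indicator {0..t} \<tau>) \<in> borel_measurable lborel"
      by measurable
    then show ?thesis by (rule measurable_cong[THEN iffD1, rotated]) (auto simp: indicator_def)
  qed
  have "(\<integral>\<^sup>+\<omega>. ennreal ((X \<omega> - step_integral W m q e \<omega>)\<^sup>2) \<partial>M) \<le> 2 * ?v j + 2 * (2 * ?u j + 2 * ?d)" for j
  proof -
    have "(\<integral>\<^sup>+\<omega>. ennreal ((X \<omega> - step_integral W m q e \<omega>)\<^sup>2) \<partial>M) \<le>
      (\<integral>\<^sup>+\<omega>. 2 * ennreal ((X \<omega> - step_integral W (n j) (p j) (c j) \<omega>)\<^sup>2) +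
         2 * ennreal ((step_integral W (n j) (p j) (c j) \<omega> - step_integral W m q e \<omega>)\<^sup>2) \<partial>M)"
      by (intro nn_integral_mono ennreal_square_diff_le)
    also have "\<dots> = 2 * ?v j + 2 * (\<integral>\<^sup>+\<omega>. ennreal ((step_integral W (n j) (p j) (c j) \<omega> - step_integral W m q e \<omega>)\<^sup>2) \<partial>M)"
      by (simp add: nn_integral_add nn_integral_cmult)
    also have "(\<integral>\<^sup>+\<omega>. ennreal ((step_integral W (n j) (p j) (c j) \<omega> - step_integral W m q e \<omega>)\<^sup>2) \<partial>M) =
        (\<integral>\<^sup>+\<tau>\<in>{0..t}. ennreal ((step_fun (n j) (p j) (c j) \<tau> - step_fun m q e \<tau>)\<^sup>2) \<partial>lborel)"
      by (rule step_isometry_diff[OF p q])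
    also have "\<dots> \<le> (\<integral>\<^sup>+\<tau>. 2 * (ennreal ((f \<tau> - step_fun (n j) (p j) (c j) \<tau>)\<^sup>2) * indicator {0..t} \<tau>) +
        2 * (ennreal ((f \<tau> - step_fun m q e \<tau>)\<^sup>2) * indicator {0..t} \<tau>) \<partial>lborel)"
      using ennreal_square_diff_le[of "step_fun (n j) (p j) (c j) _" "step_fun m q e _" "f _"]
      by (intro nn_integral_mono) (auto simp: indicator_def power2_commute[of _ "f _"])
    also have "\<dots> = 2 * ?u j + 2 * ?d"
      using fs by (simp add: nn_integral_add nn_integral_cmult)
    finally show ?thesis by (simp add: add_mono mult_left_mono)
  qed
  moreover have "(\<lambda>j. 2 * ?v j + 2 * (2 * ?u j + 2 * ?d)) \<longlonglongrightarrow> 2 * 0 + 2 * (2 * 0 + 2 * ?d)"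
    using l1 l2 by (intro tendsto_add ennreal_tendsto_cmult tendsto_const) auto
  ultimately have "(\<integral>\<^sup>+\<omega>. ennreal ((X \<omega> - step_integral W m q e \<omega>)\<^sup>2) \<partial>M) \<le> 2 * 0 + 2 * (2 * 0 + 2 * ?d)"
    by (intro LIMSEQ_le_const) auto
  then show ?thesis by (simp add: mult.assoc[symmetric])
qed

end

section \<open>Wiener integrals of continuous functions of bounded variation\<close>

text \<open>A uniform mesh with \<open>Suc m\<close> cells, so that no \<open>m\<close> leads to a
  division by zero.\<close>

definition grid :: "real \<Rightarrow> nat \<Rightarrow> nat \<Rightarrow> real" where
  "grid t m i = t * real i / real (Suc m)"

lemma grid_bounds:
  assumes "0 \<le> t" "i \<le> Suc m"
  shows "grid t m i \<in> {0..t}"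
proof -
  have "t * real i \<le> t * real (Suc m)" using assms by (intro mult_left_mono) auto
  then show ?thesis using assms by (auto simp: grid_def field_simps)
qed

lemma grid_Suc_diff: "grid t m (Suc i) - grid t m i = t / real (Suc m)"
  by (simp add: grid_def diff_divide_distrib[symmetric] distrib_left)

lemma grid_mono: "0 \<le> t \<Longrightarrow> grid t m i \<le> grid t m (Suc i)"
  using grid_Suc_diff[of t m i] divide_nonneg_nonneg[of t "real (Suc m)"] by linarith

lemma is_partition_grid: "0 \<le> t \<Longrightarrow> is_partition t (Suc m) (grid t m)"
  by (auto simp: is_partition_def grid_mono) (simp_all add: grid_def)

lemma step_fun_grid_close:
  assumes "0 \<le> t" and \<tau>: "\<tau> \<in> {0<..t}"
    and close: "\<And>u v. u \<in> {0..t} \<Longrightarrow> v \<in> {0..t} \<Longrightarrow> \<bar>u - v\<bar> \<le> t / real (Suc m) \<Longrightarrow> \<bar>f u - f v\<bar> \<le> e"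
  shows "\<bar>f \<tau> - step_fun (Suc m) (grid t m) (\<lambda>i. f (grid t m i)) \<tau>\<bar> \<le> e"
proof -
  let ?p = "grid t m"
  \<comment> \<open>Telescoping indicators of \<open>{0<..b}\<close> shows that exactly one cell
    contains \<open>\<tau>\<close>. The cells are left-open, which is why \<open>\<tau> = 0\<close>
    is excluded.\<close>
  have "(\<Sum>i<Suc m. indicator {?p i<..?p (Suc i)} \<tau> :: real) =
      (\<Sum>i<Suc m. indicator {0<..?p (Suc i)} \<tau> - indicator {0<..?p i} \<tau>)"
    using grid_mono[OF \<open>0 \<le> t\<close>] grid_bounds[OF \<open>0 \<le> t\<close>]
    by (intro sum.cong indicator_Ioc_diff) auto
  also have "\<dots> = indicator {0<..?p (Suc m)} \<tau> - indicator {0<..?p 0} \<tau>"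
    by (rule sum_lessThan_telescope)
  also have "\<dots> = 1" using \<tau> by (auto simp: grid_def)
  finally have one: "(\<Sum>i<Suc m. indicator {?p i<..?p (Suc i)} \<tau> :: real) = 1" .
  have "f \<tau> - step_fun (Suc m) ?p (\<lambda>i. f (?p i)) \<tau> =
      f \<tau> * (\<Sum>i<Suc m. indicator {?p i<..?p (Suc i)} \<tau>) - step_fun (Suc m) ?p (\<lambda>i. f (?p i)) \<tau>"
    unfolding one by simp
  also have "\<dots> = (\<Sum>i<Suc m. (f \<tau> - f (?p i)) * indicator {?p i<..?p (Suc i)} \<tau>)"
    unfolding step_fun_def sum_distrib_left sum_subtractf[symmetric] left_diff_distrib ..
  also have "\<bar>\<dots>\<bar> \<le> (\<Sum>i<Suc m. \<bar>(f \<tau> - f (?p i)) * indicator {?p i<..?p (Suc i)} \<tau>\<bar>)"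
    by (rule sum_abs)
  also have "\<dots> \<le> (\<Sum>i<Suc m. e * indicator {?p i<..?p (Suc i)} \<tau>)"
  proof (rule sum_mono)
    fix i assume i: "i \<in> {..<Suc m}"
    show "\<bar>(f \<tau> - f (?p i)) * indicator {?p i<..?p (Suc i)} \<tau>\<bar> \<le> e * indicator {?p i<..?p (Suc i)} \<tau>"
    proof (cases "\<tau> \<in> {?p i<..?p (Suc i)}")
      case True
      then have "\<bar>\<tau> - ?p i\<bar> \<le> t / real (Suc m)" using grid_Suc_diff[of t m i] by auto
      then show ?thesis using True close[of \<tau> "?p i"] \<tau> grid_bounds[OF \<open>0 \<le> t\<close>, of i m] i by auto
    qed simp
  qed
  also have "\<dots> = e" unfolding sum_distrib_left[symmetric] one by simp
  finally show ?thesis .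
qed

lemma step_fun_grid_L2_tendsto:
  assumes t: "0 \<le> t" and f: "continuous_on {0..t} f"
  shows "(\<lambda>m. \<integral>\<^sup>+\<tau>\<in>{0..t}. ennreal ((f \<tau> - step_fun (Suc m) (grid t m) (\<lambda>i. f (grid t m i)) \<tau>)\<^sup>2) \<partial>lborel) \<longlonglongrightarrow> 0"
proof (rule order_tendstoI)
  let ?u = "\<lambda>m. \<integral>\<^sup>+\<tau>\<in>{0..t}. ennreal ((f \<tau> - step_fun (Suc m) (grid t m) (\<lambda>i. f (grid t m i)) \<tau>)\<^sup>2) \<partial>lborel"
  fix \<epsilon> :: ennreal assume "0 < \<epsilon>"
  then obtain r :: real where r: "0 < ennreal r" "ennreal r < \<epsilon>"
    by (metis dense ennreal_cases infinity_ennreal_def less_top_ennreal order.strict_trans top.not_eq_extremum)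
  then have r0: "0 < r" by (simp add: ennreal_less_zero_iff)
  \<comment> \<open>Then \<open>e^2 * t = r * t / (t + 1) \<le> r\<close>; the \<open>+ 1\<close>
    also covers \<open>t = 0\<close>.\<close>
  define e where "e = sqrt (r / (t + 1))"
  have e: "0 < e" using r0 t by (simp add: e_def)
  have "uniformly_continuous_on {0..t} f"
    using f by (rule compact_uniformly_continuous) simp
  then obtain d where d: "0 < d" "\<And>u v. u \<in> {0..t} \<Longrightarrow> v \<in> {0..t} \<Longrightarrow> dist v u < d \<Longrightarrow> dist (f v) (f u) < e"
    using e unfolding uniformly_continuous_on_def by metis
  have "(\<lambda>m. t / real (Suc m)) \<longlonglongrightarrow> 0" by (rule LIMSEQ_Suc[OF lim_const_over_n])
  then have "\<forall>\<^sub>F m in sequentially. t / real (Suc m) < d" using d(1) by (rule order_tendstoD)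
  then show "\<forall>\<^sub>F m in sequentially. ?u m < \<epsilon>"
  proof eventually_elim
    case (elim m)
    have "?u m \<le> (\<integral>\<^sup>+\<tau>. ennreal (e\<^sup>2) * indicator {0..t} \<tau> \<partial>lborel)"
    proof (rule nn_integral_mono_AE)
      show "AE \<tau> in lborel. ennreal ((f \<tau> - step_fun (Suc m) (grid t m) (\<lambda>i. f (grid t m i)) \<tau>)\<^sup>2) * indicator {0..t} \<tau>
          \<le> ennreal (e\<^sup>2) * indicator {0..t} \<tau>"
        \<comment> \<open>At \<open>\<tau> = 0\<close> the step function vanishes whatever
          \<open>f\<close> is, so this point is discarded.\<close>
        using AE_lborel_singleton[of 0]
      proof eventually_elim
        case (elim \<tau>)
        have "\<bar>f \<tau> - step_fun (Suc m) (grid t m) (\<lambda>i. f (grid t m i)) \<tau>\<bar> \<le> e" if "\<tau> \<in> {0..t}"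
        proof (rule step_fun_grid_close[OF t])
          show "\<tau> \<in> {0<..t}" using that elim by auto
          show "\<bar>f u - f v\<bar> \<le> e" if "u \<in> {0..t}" "v \<in> {0..t}" "\<bar>u - v\<bar> \<le> t / real (Suc m)" for u v
            using d(2)[OF that(2,1)] that(3) \<open>t / real (Suc m) < d\<close> by (auto simp: dist_real_def)
        qed
        then show ?case
          using e by (auto simp: indicator_def abs_le_square_iff[symmetric] intro!: ennreal_leI)
      qed
    qed
    also have "\<dots> = ennreal (e\<^sup>2) * ennreal t" using t by (simp add: nn_integral_cmult)
    also have "\<dots> = ennreal (r / (t + 1) * t)" using t r0 by (simp add: e_def ennreal_mult'[symmetric])
    also have "\<dots> \<le> ennreal r" using t r0 by (intro ennreal_leI) (simp add: field_simps)
    also note r(2)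
    finally show ?case .
  qed
qed simp

text \<open>Abel summation moves the differences from \<open>w\<close> to \<open>h\<close>. The two
  boundary terms and the remaining sum are each at most \<open>K * V\<close>, hence the factor
  3.\<close>

lemma summation_by_parts_bound:
  fixes h w :: "nat \<Rightarrow> real"
  assumes w: "\<And>i. i \<le> n \<Longrightarrow> \<bar>w i\<bar> \<le> K" and h: "\<And>i. i \<le> n \<Longrightarrow> \<bar>h i\<bar> \<le> V"
    and var: "(\<Sum>i<n. \<bar>h (Suc i) - h i\<bar>) \<le> V"
  shows "\<bar>\<Sum>i<n. h i * (w (Suc i) - w i)\<bar> \<le> 3 * K * V"
proof -
  have K: "0 \<le> K" using w[of 0] by (auto intro: order_trans[OF abs_ge_zero])
  have eq: "(\<Sum>i<k. h i * (w (Suc i) - w i)) = h k * w k - h 0 * w 0 - (\<Sum>i<k. w (Suc i) * (h (Suc i) - h i))" for k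
    by (induction k) (simp_all add: algebra_simps)
  have "\<bar>\<Sum>i<n. w (Suc i) * (h (Suc i) - h i)\<bar> \<le> (\<Sum>i<n. K * \<bar>h (Suc i) - h i\<bar>)"
    using w by (intro order_trans[OF sum_abs] sum_mono) (auto simp: abs_mult intro!: mult_right_mono)
  also have "\<dots> \<le> K * V" unfolding sum_distrib_left[symmetric] using var K by (rule mult_left_mono)
  finally have s: "\<bar>\<Sum>i<n. w (Suc i) * (h (Suc i) - h i)\<bar> \<le> K * V" .
  have "\<bar>h i * w i\<bar> \<le> K * V" if "i \<le> n" for i
    using mult_mono[OF h[OF that] w[OF that]] K order_trans[OF abs_ge_zero h[OF that]] by (simp add: abs_mult mult.commute)
  from this[of 0] this[of n] s show ?thesis unfolding eq by linarith
qed

text \<open>The Riemann sums obey the bound on every path, but converge only in \<open>L\<^sup>2\<close>; Fatou's lemma transfers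
  the bound to the limit without extracting a subsequence.\<close>

lemma (in standard_brownian_motion) wiener_integral_diff_bound:
  assumes t: "0 \<le> t" and X: "has_wiener_integral M W t f X" and Y: "has_wiener_integral M W t g Y"
    and f: "continuous_on {0..t} f" and g: "continuous_on {0..t} g"
    and bound: "\<And>\<tau>. \<tau> \<in> {0..t} \<Longrightarrow> \<bar>f \<tau> - g \<tau>\<bar> \<le> V"
    and var: "\<And>m. (\<Sum>i<Suc m. \<bar>(f (grid t m (Suc i)) - g (grid t m (Suc i))) - (f (grid t m i) - g (grid t m i))\<bar>) \<le> V"
  shows "AE \<omega> in M. \<forall>K. (\<forall>s\<in>{0..t}. \<bar>W s \<omega>\<bar> \<le> K) \<longrightarrow> \<bar>X \<omega> - Y \<omega>\<bar> \<le> 3 * K * V"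
proof -
  let ?S = "\<lambda>f m. step_integral W (Suc m) (grid t m) (\<lambda>i. f (grid t m i))"
  let ?F = "\<lambda>m \<omega>. ennreal (((X \<omega> - ?S f m \<omega>) - (Y \<omega> - ?S g m \<omega>))\<^sup>2)"
  have [measurable]: "X \<in> borel_measurable M" "Y \<in> borel_measurable M"
    using X Y by (auto simp: has_wiener_integral_def)
  note p = is_partition_grid[OF t]
  note [measurable] = step_integral_measurable[OF p]
  let ?u = "\<lambda>f m. \<integral>\<^sup>+\<tau>\<in>{0..t}. ennreal ((f \<tau> - step_fun (Suc m) (grid t m) (\<lambda>i. f (grid t m i)) \<tau>)\<^sup>2) \<partial>lborel"
  have le: "(\<integral>\<^sup>+\<omega>. ?F m \<omega> \<partial>M) \<le> 2 * (4 * ?u f m) + 2 * (4 * ?u g m)" for m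
  proof -
    have "(\<integral>\<^sup>+\<omega>. ?F m \<omega> \<partial>M) \<le> (\<integral>\<^sup>+\<omega>. 2 * ennreal ((X \<omega> - ?S f m \<omega>)\<^sup>2) + 2 * ennreal ((Y \<omega> - ?S g m \<omega>)\<^sup>2) \<partial>M)"
      using ennreal_square_diff_le[where y=0] by (intro nn_integral_mono) simp
    also have "\<dots> = 2 * (\<integral>\<^sup>+\<omega>. ennreal ((X \<omega> - ?S f m \<omega>)\<^sup>2) \<partial>M) + 2 * (\<integral>\<^sup>+\<omega>. ennreal ((Y \<omega> - ?S g m \<omega>)\<^sup>2) \<partial>M)"
      by (simp add: nn_integral_add nn_integral_cmult)
    also have "\<dots> \<le> 2 * (4 * ?u f m) + 2 * (4 * ?u g m)"
      by (intro add_mono mult_left_mono wiener_integral_step_distance[OF X p] wiener_integral_step_distance[OF Y p]) auto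
    finally show ?thesis .
  qed
  have "(\<lambda>m. 2 * (4 * ?u f m) + 2 * (4 * ?u g m)) \<longlonglongrightarrow> 2 * (4 * 0) + 2 * (4 * 0)"
    by (intro tendsto_add ennreal_tendsto_cmult step_fun_grid_L2_tendsto[OF t f] step_fun_grid_L2_tendsto[OF t g])
      simp_all
  then have lim: "(\<lambda>m. 2 * (4 * ?u f m) + 2 * (4 * ?u g m)) \<longlonglongrightarrow> 0" by simp
  have "(\<lambda>m. \<integral>\<^sup>+\<omega>. ?F m \<omega> \<partial>M) \<longlonglongrightarrow> 0"
    by (rule tendsto_sandwich[OF _ _ tendsto_const lim]) (simp_all only: le zero_le eventually_True)
  then have "liminf (\<lambda>m. \<integral>\<^sup>+\<omega>. ?F m \<omega> \<partial>M) = 0"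
    by (intro lim_imp_Liminf) auto
  then have "(\<integral>\<^sup>+\<omega>. liminf (\<lambda>m. ?F m \<omega>) \<partial>M) = 0"
    using nn_integral_liminf[of ?F M] by simp
  \<comment> \<open>This null set is fixed before \<open>K\<close>; hence \<open>K\<close> may later
    depend on the path, as \<open>sup |W|\<close> does.\<close>
  then have "AE \<omega> in M. liminf (\<lambda>m. ?F m \<omega>) = 0"
    by (subst (asm) nn_integral_0_iff_AE) auto
  then show ?thesis
  proof eventually_elim
    case (elim \<omega>)
    show ?case
    proof (intro allI impI, rule ccontr)
      fix K assume K: "\<forall>s\<in>{0..t}. \<bar>W s \<omega>\<bar> \<le> K" and "\<not> \<bar>X \<omega> - Y \<omega>\<bar> \<le> 3 * K * V"
      \<comment> \<open>The excess over the bound. The Riemann sums of \<open>f - g\<close> respect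
        the bound, so for every \<open>m\<close> they stay at distance at least
        \<open>\<eta>\<close> from \<open>X - Y\<close>, contradicting the zero
        \<open>liminf\<close>.\<close>
      define \<eta> where "\<eta> = \<bar>X \<omega> - Y \<omega>\<bar> - 3 * K * V"
      have \<eta>: "0 < \<eta>" using \<open>\<not> _\<close> by (simp add: \<eta>_def)
      have "ennreal (\<eta>\<^sup>2) \<le> ?F m \<omega>" for m
      proof -
        let ?h = "\<lambda>i. f (grid t m i) - g (grid t m i)"
        have "?S f m \<omega> - ?S g m \<omega> = (\<Sum>i<Suc m. ?h i * (W (grid t m (Suc i)) \<omega> - W (grid t m i) \<omega>))"
          unfolding step_integral_def sum_subtractf[symmetric] left_diff_distrib ..
        moreover have "\<bar>\<Sum>i<Suc m. ?h i * (W (grid t m (Suc i)) \<omega> - W (grid t m i) \<omega>)\<bar> \<le> 3 * K * V"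
          using K bound grid_bounds[OF t] var by (intro summation_by_parts_bound) auto
        ultimately have "\<eta> \<le> \<bar>(X \<omega> - ?S f m \<omega>) - (Y \<omega> - ?S g m \<omega>)\<bar>"
          unfolding \<eta>_def by linarith
        then show ?thesis using \<eta> by (intro ennreal_leI) (simp add: abs_le_square_iff[symmetric])
      qed
      then have "ennreal (\<eta>\<^sup>2) \<le> liminf (\<lambda>m. ?F m \<omega>)" by (intro Liminf_bounded) auto
      with elim \<eta> show False by simp
    qed
  qed
qed

section \<open>Uniform convergence\<close>

text \<open>The series with all signs removed. Under the summability condition below it is
  nondecreasing for \<open>u \<ge> 0\<close> and its increments dominate those of
  \<open>frac_series\<close>, so its value at \<open>t\<close> bounds the variation up to
  \<open>t\<close>.\<close>

definition frac_majorant :: "real \<Rightarrow> (nat \<Rightarrow> real) \<Rightarrow> real \<Rightarrow> real" where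
  "frac_majorant \<rho> c u = (\<Sum>k. \<bar>c k\<bar> / Gamma (real k * \<rho> + 1) * (u powr \<rho>) ^ k)"

text \<open>A finite weighted \<open>l^1\<close> norm for one \<open>d\<close> already gives
  convergence for every \<open>z\<close>, since the Gamma denominators beat any ratio between
  \<open>|z|\<close> and \<open>d\<close>.\<close>

lemma summable_frac_series_terms:
  fixes \<rho> d z :: real
  assumes \<rho>: "1 < \<rho>" and d: "0 < d" and c: "summable (\<lambda>k. d ^ k / fact k * \<bar>c k\<bar>)"
  shows "summable (\<lambda>k. \<bar>c k\<bar> / Gamma (real k * \<rho> + 1) * \<bar>z\<bar> ^ k)"
    and "summable (\<lambda>k. c k / Gamma (real k * \<rho> + 1) * z ^ k)"
proof -
  obtain C where C: "0 \<le> C" "\<And>k. (\<bar>z\<bar> + 1) ^ k / Gamma (real k * \<rho> + 1) \<le> C * (d ^ k / fact k)"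
    using inverse_Gamma_bound[of \<rho> "\<bar>z\<bar> + 1" d] \<rho> d by (auto simp: add_nonneg_pos)
  have G: "0 < Gamma (real k * \<rho> + 1)" for k using fact_le_Gamma(2)[of \<rho> k] \<rho> by auto
  show *: "summable (\<lambda>k. \<bar>c k\<bar> / Gamma (real k * \<rho> + 1) * \<bar>z\<bar> ^ k)"
  proof (rule summable_comparison_test'[of _ 0])
    show "summable (\<lambda>k. C * (d ^ k / fact k * \<bar>c k\<bar>))" using c by (rule summable_mult)
    fix k
    have "\<bar>z\<bar> ^ k / Gamma (real k * \<rho> + 1) \<le> (\<bar>z\<bar> + 1) ^ k / Gamma (real k * \<rho> + 1)"
      using G[of k] by (intro divide_right_mono power_mono) auto
    also note C(2)
    finally have "\<bar>c k\<bar> * (\<bar>z\<bar> ^ k / Gamma (real k * \<rho> + 1)) \<le> \<bar>c k\<bar> * (C * (d ^ k / fact k))"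
      by (rule mult_left_mono) simp
    moreover have "0 \<le> \<bar>c k\<bar> / Gamma (real k * \<rho> + 1) * \<bar>z\<bar> ^ k"
      using G[of k] by simp
    ultimately show "norm (\<bar>c k\<bar> / Gamma (real k * \<rho> + 1) * \<bar>z\<bar> ^ k) \<le> C * (d ^ k / fact k * \<bar>c k\<bar>)"
      by (simp add: mult_ac)
  qed
  show "summable (\<lambda>k. c k / Gamma (real k * \<rho> + 1) * z ^ k)"
  proof (rule summable_rabs_cancel)
    have "\<bar>c k / Gamma (real k * \<rho> + 1) * z ^ k\<bar> = \<bar>c k\<bar> / Gamma (real k * \<rho> + 1) * \<bar>z\<bar> ^ k" for k
      using abs_of_pos[OF G[of k]] by (simp only: abs_mult abs_divide power_abs)
    then show "summable (\<lambda>k. \<bar>c k / Gamma (real k * \<rho> + 1) * z ^ k\<bar>)"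
      using * by (simp only:)
  qed
qed

context
  fixes \<rho> d :: real and c :: "nat \<Rightarrow> real"
  assumes \<rho>: "1 < \<rho>" and d: "0 < d" and c: "summable (\<lambda>k. d ^ k / fact k * \<bar>c k\<bar>)"
begin

private lemma Gpos: "0 < Gamma (real k * \<rho> + 1)"
  using fact_le_Gamma(2)[of \<rho> k] \<rho> by auto

private lemma sm: "summable (\<lambda>k. \<bar>c k\<bar> / Gamma (real k * \<rho> + 1) * (u powr \<rho>) ^ k)"
  using summable_frac_series_terms(1)[OF \<rho> d c, of "u powr \<rho>"] by simp

lemma continuous_on_frac_series: "continuous_on {0..} (frac_series \<rho> c)"
proof -
  define E where "E z = (\<Sum>k. c k / Gamma (real k * \<rho> + 1) * z ^ k)" for z
  have cE: "isCont E z" for z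
    unfolding E_def by (rule isCont_powser_converges_everywhere[OF summable_frac_series_terms(2)[OF \<rho> d c]])
  have "continuous_on {0..} (\<lambda>t. - (t powr \<rho>))"
    using \<rho> by (intro continuous_intros continuous_on_powr') auto
  then have "continuous_on {0..} (\<lambda>t. E (- (t powr \<rho>)))"
    by (rule continuous_on_compose2[of UNIV E, rotated])
      (auto intro!: continuous_at_imp_continuous_on cE)
  then show ?thesis by (simp add: E_def frac_series_def[abs_def])
qed

text \<open>Each term is a monotone power up to sign, and
  \<open>|(- x)^k - (- y)^k| = x^k - y^k\<close> for \<open>0 \<le> y \<le> x\<close>. This controls
  the variation without differentiating the fractional power.\<close>

lemma frac_series_increment:
  assumes "0 \<le> v" "v \<le> u"
  shows "\<bar>frac_series \<rho> c u - frac_series \<rho> c v\<bar> \<le> frac_majorant \<rho> c u - frac_majorant \<rho> c v"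
proof -
  let ?t = "\<lambda>k u. c k / Gamma (real k * \<rho> + 1) * (- (u powr \<rho>)) ^ k"
  let ?M = "\<lambda>k u. \<bar>c k\<bar> / Gamma (real k * \<rho> + 1) * (u powr \<rho>) ^ k"
  have le: "\<bar>?t k u - ?t k v\<bar> \<le> ?M k u - ?M k v" for k
  proof -
    have "(v powr \<rho>) ^ k \<le> (u powr \<rho>) ^ k"
      using assms \<rho> by (intro power_mono powr_mono2) auto
    then have "\<bar>(- (u powr \<rho>)) ^ k - (- (v powr \<rho>)) ^ k\<bar> = (u powr \<rho>) ^ k - (v powr \<rho>) ^ k"
      unfolding power_minus[of "_ powr _"] right_diff_distrib[symmetric] abs_mult by (simp add: power_abs)
    moreover have "\<bar>g * x - g * y\<bar> = \<bar>g\<bar> * \<bar>x - y\<bar>" for g x y :: real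
      unfolding right_diff_distrib[symmetric] by (rule abs_mult)
    moreover have "\<bar>c k / Gamma (real k * \<rho> + 1)\<bar> = \<bar>c k\<bar> / Gamma (real k * \<rho> + 1)"
      unfolding abs_divide abs_of_pos[OF Gpos] by (rule refl)
    ultimately have "\<bar>?t k u - ?t k v\<bar> = \<bar>c k\<bar> / Gamma (real k * \<rho> + 1) * ((u powr \<rho>) ^ k - (v powr \<rho>) ^ k)"
      by (simp only:)
    also have "\<dots> = ?M k u - ?M k v" by (rule right_diff_distrib)
    finally show ?thesis by (rule eq_refl)
  qed
  have sM: "summable (\<lambda>k. ?M k u - ?M k v)" by (intro summable_diff sm)
  have sa: "summable (\<lambda>k. \<bar>?t k u - ?t k v\<bar>)"
    by (rule summable_comparison_test'[OF sM, of 0]) (unfold real_norm_def abs_idempotent, rule le)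
  have eq: "frac_series \<rho> c u - frac_series \<rho> c v = (\<Sum>k. ?t k u - ?t k v)"
    unfolding frac_series_def by (intro suminf_diff summable_frac_series_terms(2)[OF \<rho> d c])
  have "\<bar>frac_series \<rho> c u - frac_series \<rho> c v\<bar> \<le> (\<Sum>k. \<bar>?t k u - ?t k v\<bar>)"
    unfolding eq by (rule summable_rabs[OF sa])
  also have "\<dots> \<le> (\<Sum>k. ?M k u - ?M k v)" by (rule suminf_le[OF le sa sM])
  also have "\<dots> = frac_majorant \<rho> c u - frac_majorant \<rho> c v"
    unfolding frac_majorant_def by (rule suminf_diff[symmetric, OF sm sm])
  finally show ?thesis .
qed

lemma abs_frac_series_le: "\<bar>frac_series \<rho> c u\<bar> \<le> frac_majorant \<rho> c u"
proof -
  let ?t = "\<lambda>k. c k / Gamma (real k * \<rho> + 1) * (- (u powr \<rho>)) ^ k"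
  have eq: "\<bar>?t k\<bar> = \<bar>c k\<bar> / Gamma (real k * \<rho> + 1) * (u powr \<rho>) ^ k" for k
    using abs_of_pos[OF Gpos[of k]] by (simp only: abs_mult abs_divide power_abs abs_minus_cancel abs_of_nonneg powr_ge_zero)
  have "summable (\<lambda>k. \<bar>?t k\<bar>)" unfolding eq by (rule sm)
  then have "\<bar>suminf ?t\<bar> \<le> (\<Sum>k. \<bar>?t k\<bar>)" by (rule summable_rabs)
  then show ?thesis by (simp only: eq frac_series_def frac_majorant_def)
qed

lemma frac_majorant_nonneg: "0 \<le> frac_majorant \<rho> c u"
  using abs_frac_series_le[of u] by linarith

lemma frac_majorant_mono: "0 \<le> v \<Longrightarrow> v \<le> u \<Longrightarrow> frac_majorant \<rho> c v \<le> frac_majorant \<rho> c u"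
  using frac_series_increment[of v u] by linarith

text \<open>All dependence on the horizon \<open>T\<close> is collected in \<open>C\<close>; the
  other factor is the norm in which the empirical moments converge.\<close>

lemma frac_majorant_le:
  assumes C: "\<And>k. (T powr \<rho>) ^ k / Gamma (real k * \<rho> + 1) \<le> C * (d ^ k / fact k)"
  shows "frac_majorant \<rho> c T \<le> C * (\<Sum>k. d ^ k / fact k * \<bar>c k\<bar>)"
proof -
  have "frac_majorant \<rho> c T \<le> (\<Sum>k. C * (d ^ k / fact k * \<bar>c k\<bar>))"
    unfolding frac_majorant_def
  proof (rule suminf_le[OF _ sm summable_mult[OF c]])
    fix k
    have "\<bar>c k\<bar> * ((T powr \<rho>) ^ k / Gamma (real k * \<rho> + 1)) \<le> \<bar>c k\<bar> * (C * (d ^ k / fact k))"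
      using C[of k] by (rule mult_left_mono) simp
    moreover have "\<bar>c k\<bar> / Gamma (real k * \<rho> + 1) * (T powr \<rho>) ^ k = \<bar>c k\<bar> * ((T powr \<rho>) ^ k / Gamma (real k * \<rho> + 1))"
      by simp
    moreover have "C * (d ^ k / fact k * \<bar>c k\<bar>) = \<bar>c k\<bar> * (C * (d ^ k / fact k))"
      by (simp only: mult_ac)
    ultimately show "\<bar>c k\<bar> / Gamma (real k * \<rho> + 1) * (T powr \<rho>) ^ k \<le> C * (d ^ k / fact k * \<bar>c k\<bar>)"
      by (simp only:)
  qed
  also have "\<dots> = C * (\<Sum>k. d ^ k / fact k * \<bar>c k\<bar>)" using c by (rule suminf_mult)
  finally show ?thesis .
qed

text \<open>The increments of the majorant telescope. Time runs backwards in
  \<open>t - grid t m i\<close>, so the surviving value is the one at the largest argument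
  \<open>t\<close>.\<close>

lemma frac_series_grid_variation:
  assumes t: "0 \<le> t"
  shows "(\<Sum>i<Suc m. \<bar>frac_series \<rho> c (t - grid t m (Suc i)) - frac_series \<rho> c (t - grid t m i)\<bar>) \<le> frac_majorant \<rho> c t"
proof -
  have "(\<Sum>i<Suc m. \<bar>frac_series \<rho> c (t - grid t m (Suc i)) - frac_series \<rho> c (t - grid t m i)\<bar>) \<le>
    (\<Sum>i<Suc m. frac_majorant \<rho> c (t - grid t m i) - frac_majorant \<rho> c (t - grid t m (Suc i)))"
  proof (rule sum_mono)
    fix i assume "i \<in> {..<Suc m}"
    then have "0 \<le> t - grid t m (Suc i)" "t - grid t m (Suc i) \<le> t - grid t m i"
      using grid_mono[OF t, of m i] grid_bounds[OF t, of "Suc i" m] by simp_all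
    from frac_series_increment[OF this]
    show "\<bar>frac_series \<rho> c (t - grid t m (Suc i)) - frac_series \<rho> c (t - grid t m i)\<bar> \<le>
      frac_majorant \<rho> c (t - grid t m i) - frac_majorant \<rho> c (t - grid t m (Suc i))"
      by (simp only: abs_minus_commute)
  qed
  also have "\<dots> = frac_majorant \<rho> c (t - grid t m 0) - frac_majorant \<rho> c (t - grid t m (Suc m))"
    by (rule sum_lessThan_telescope')
  also have "\<dots> \<le> frac_majorant \<rho> c t"
    using frac_majorant_nonneg by (simp add: grid_def)
  finally show ?thesis .
qed

end

lemma frac_series_diff:
  assumes "1 < \<rho>" "0 < d" "summable (\<lambda>k. d ^ k / fact k * \<bar>c k\<bar>)" "summable (\<lambda>k. d ^ k / fact k * \<bar>e k\<bar>)"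
  shows "frac_series \<rho> c u - frac_series \<rho> e u = frac_series \<rho> (\<lambda>k. c k - e k) u"
proof -
  have "frac_series \<rho> c u - frac_series \<rho> e u = (\<Sum>k. c k / Gamma (real k * \<rho> + 1) * (- (u powr \<rho>)) ^ k
      - e k / Gamma (real k * \<rho> + 1) * (- (u powr \<rho>)) ^ k)"
    unfolding frac_series_def using assms by (intro suminf_diff summable_frac_series_terms(2)[where d=d])
  then show ?thesis by (simp only: frac_series_def diff_divide_distrib left_diff_distrib)
qed

lemma summable_average_powers:
  fixes a :: "nat \<Rightarrow> real"
  assumes "0 < d"
  shows "summable (\<lambda>j. d ^ j / fact j * \<bar>(\<Sum>k=1..n. a k ^ j) / real n\<bar>)"
proof (rule summable_comparison_test'[of _ 0])
  have "summable (\<lambda>j. (\<Sum>k=1..n. (d * \<bar>a k\<bar>) ^ j /\<^sub>R fact j) / real n)"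
    by (intro summable_divide summable_sum sums_summable[OF exp_converges])
  then show "summable (\<lambda>j. d ^ j / fact j * ((\<Sum>k=1..n. \<bar>a k\<bar> ^ j) / real n))"
    by (simp add: power_mult_distrib inverse_eq_divide sum_distrib_left)
  fix j
  have "\<bar>\<Sum>k=1..n. a k ^ j\<bar> \<le> (\<Sum>k=1..n. \<bar>a k\<bar> ^ j)"
    using sum_abs[of "\<lambda>k. a k ^ j" "{1..n}"] by (simp add: power_abs)
  then show "norm (d ^ j / fact j * \<bar>(\<Sum>k=1..n. a k ^ j) / real n\<bar>) \<le> d ^ j / fact j * ((\<Sum>k=1..n. \<bar>a k\<bar> ^ j) / real n)"
    using assms by (simp add: abs_mult power_abs divide_right_mono mult_left_mono)
qed

lemma average_scalar_resolvent:
  assumes "1 < \<rho>" "0 \<le> u"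
  shows "1 / real n * (\<Sum>k=1..n. scalar_resolvent \<rho> (a k) u) = frac_series \<rho> (\<lambda>j. (\<Sum>k=1..n. a k ^ j) / real n) u"
proof -
  let ?t = "\<lambda>k j. a k ^ j / Gamma (real j * \<rho> + 1) * (- (u powr \<rho>)) ^ j"
  have s: "summable (?t k)" for k
    using summable_frac_series_terms(2)[OF assms(1), of 1 "\<lambda>j. a k ^ j" "- (u powr \<rho>)"]
      summable_average_powers[of 1 "\<lambda>_. a k" 1] by simp
  have "1 / real n * (\<Sum>k=1..n. scalar_resolvent \<rho> (a k) u) = 1 / real n * (\<Sum>k=1..n. \<Sum>j. ?t k j)"
    using assms by (simp add: scalar_resolvent_eq_frac_series frac_series_def)
  also have "(\<Sum>k=1..n. \<Sum>j. ?t k j) = (\<Sum>j. \<Sum>k=1..n. ?t k j)"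
    using s by (rule suminf_sum[symmetric])
  also have "1 / real n * \<dots> = (\<Sum>j. 1 / real n * (\<Sum>k=1..n. ?t k j))"
    using s by (intro suminf_mult[symmetric] summable_sum)
  also have "\<dots> = frac_series \<rho> (\<lambda>j. (\<Sum>k=1..n. a k ^ j) / real n) u"
    unfolding frac_series_def by (intro suminf_cong) (simp add: sum_distrib_right sum_divide_distrib mult.commute[of "Gamma _"])
  finally show ?thesis .
qed

lemma G_fun_eq_frac_series:
  "G_fun \<rho> \<mu> (- (u powr \<rho> / lam)) = frac_series \<rho> (\<lambda>k. pochhammer \<mu> k / lam ^ k) u"
proof -
  have "(- (u powr \<rho> / lam)) ^ k = (- (u powr \<rho>)) ^ k / lam ^ k" for k
    by (metis minus_divide_left power_divide)
  then show ?thesis by (simp add: G_fun_def frac_series_def mult.commute[of "Gamma _"])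
qed

text \<open>One number, \<open>C\<close> times the coefficient distance, bounds both the difference
  of the integrands and its variation for all \<open>t \<le> T\<close>. \<open>f\<close> and
  \<open>g\<close> are prescribed only on \<open>{0..t}\<close>, where
  \<open>t - \<tau> \<ge> 0\<close> and the resolvent agrees with its series.\<close>

lemma (in standard_brownian_motion) frac_series_wiener_bound:
  assumes \<rho>: "1 < \<rho>" and d: "0 < d"
    and a: "summable (\<lambda>k. d ^ k / fact k * \<bar>a k\<bar>)" and b: "summable (\<lambda>k. d ^ k / fact k * \<bar>b k\<bar>)"
    and C: "\<And>k. (T powr \<rho>) ^ k / Gamma (real k * \<rho> + 1) \<le> C * (d ^ k / fact k)"
    and t: "t \<in> {0..T}"
    and X: "has_wiener_integral M W t f X" and Y: "has_wiener_integral M W t g Y"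
    and f: "\<And>\<tau>. \<tau> \<in> {0..t} \<Longrightarrow> f \<tau> = frac_series \<rho> a (t - \<tau>)"
    and g: "\<And>\<tau>. \<tau> \<in> {0..t} \<Longrightarrow> g \<tau> = frac_series \<rho> b (t - \<tau>)"
  shows "AE \<omega> in M. \<forall>K. (\<forall>s\<in>{0..t}. \<bar>W s \<omega>\<bar> \<le> K) \<longrightarrow>
    \<bar>X \<omega> - Y \<omega>\<bar> \<le> 3 * K * (C * (\<Sum>k. d ^ k / fact k * \<bar>a k - b k\<bar>))"
proof (rule wiener_integral_diff_bound[OF _ X Y])
  define c where "c k = a k - b k" for k
  have c: "summable (\<lambda>k. d ^ k / fact k * \<bar>c k\<bar>)"
  proof (rule summable_comparison_test'[OF summable_add[OF a b], of 0])
    fix k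
    have "d ^ k / fact k * \<bar>c k\<bar> \<le> d ^ k / fact k * (\<bar>a k\<bar> + \<bar>b k\<bar>)"
      unfolding c_def using d by (intro mult_left_mono) auto
    then show "norm (d ^ k / fact k * \<bar>c k\<bar>) \<le> d ^ k / fact k * \<bar>a k\<bar> + d ^ k / fact k * \<bar>b k\<bar>"
      using d by (simp add: abs_mult distrib_left)
  qed
  have fg: "f \<tau> - g \<tau> = frac_series \<rho> c (t - \<tau>)" if "\<tau> \<in> {0..t}" for \<tau>
    using frac_series_diff[OF \<rho> d a b] f[OF that] g[OF that] by (simp add: c_def[abs_def])
  have V: "frac_majorant \<rho> c u \<le> C * (\<Sum>k. d ^ k / fact k * \<bar>a k - b k\<bar>)" if "0 \<le> u" "u \<le> T" for u
    using frac_majorant_mono[OF \<rho> d c that] frac_majorant_le[OF \<rho> d c C] by (simp add: c_def[abs_def])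
  show "0 \<le> t" using t by simp
  have cont: "continuous_on {0..t} (\<lambda>\<tau>. frac_series \<rho> e (t - \<tau>))" if "summable (\<lambda>k. d ^ k / fact k * \<bar>e k\<bar>)" for e
    by (rule continuous_on_compose2[OF continuous_on_frac_series[OF \<rho> d that]]) (auto intro!: continuous_intros)
  show "continuous_on {0..t} f" using cont[OF a] by (rule continuous_on_eq) (simp add: f)
  show "continuous_on {0..t} g" using cont[OF b] by (rule continuous_on_eq) (simp add: g)
  show "\<bar>f \<tau> - g \<tau>\<bar> \<le> C * (\<Sum>k. d ^ k / fact k * \<bar>a k - b k\<bar>)" if "\<tau> \<in> {0..t}" for \<tau>
    unfolding fg[OF that] using abs_frac_series_le[OF \<rho> d c, of "t - \<tau>"] V[of "t - \<tau>"] that t by auto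
  show "(\<Sum>i<Suc m. \<bar>f (grid t m (Suc i)) - g (grid t m (Suc i)) - (f (grid t m i) - g (grid t m i))\<bar>)
      \<le> C * (\<Sum>k. d ^ k / fact k * \<bar>a k - b k\<bar>)" for m
  proof -
    have "(\<Sum>i<Suc m. \<bar>f (grid t m (Suc i)) - g (grid t m (Suc i)) - (f (grid t m i) - g (grid t m i))\<bar>) =
      (\<Sum>i<Suc m. \<bar>frac_series \<rho> c (t - grid t m (Suc i)) - frac_series \<rho> c (t - grid t m i)\<bar>)"
    proof (intro sum.cong refl)
      fix i assume "i \<in> {..<Suc m}"
      then have "grid t m i \<in> {0..t}" "grid t m (Suc i) \<in> {0..t}" using t grid_bounds[of t i m] grid_bounds[of t "Suc i" m] by simp_all
      then show "\<bar>f (grid t m (Suc i)) - g (grid t m (Suc i)) - (f (grid t m i) - g (grid t m i))\<bar> =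
          \<bar>frac_series \<rho> c (t - grid t m (Suc i)) - frac_series \<rho> c (t - grid t m i)\<bar>"
        by (simp only: fg)
    qed
    also have "\<dots> \<le> frac_majorant \<rho> c t" using t by (intro frac_series_grid_variation[OF \<rho> d c]) auto
    also have "\<dots> \<le> C * (\<Sum>k. d ^ k / fact k * \<bar>a k - b k\<bar>)" using V t by auto
    finally show ?thesis .
  qed
qed

section \<open>Rational times and almost sure statements on the product space\<close>

lemma closure_Rats_Icc:
  fixes T :: real
  assumes "0 < T"
  shows "closure ({0..T} \<inter> \<rat>) = {0..T}"
proof
  show "closure ({0..T} \<inter> \<rat>) \<subseteq> {0..T}" by (rule closure_minimal) auto
  show "{0..T} \<subseteq> closure ({0..T} \<inter> \<rat>)"
  proof
    fix x assume x: "x \<in> {0..T}"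
    show "x \<in> closure ({0..T} \<inter> \<rat>)"
      unfolding closure_approachable
    proof (intro allI impI)
      fix e :: real assume "0 < e"
      \<comment> \<open>As \<open>0 < T\<close>, the window around \<open>x\<close> meets the
        interior of the interval, so a rational is found inside even when \<open>T\<close> is
        irrational.\<close>
      then have "max 0 (x - e) < min T (x + e)" using x assms by auto
      then obtain q where "q \<in> \<rat>" "max 0 (x - e) < q" "q < min T (x + e)" using Rats_dense_in_real by blast
      then show "\<exists>y\<in>{0..T} \<inter> \<rat>. dist y x < e" by (intro bexI[of _ q]) (auto simp: dist_real_def)
    qed
  qed
qed

text \<open>Estimates proved almost surely for each fixed time hold simultaneously only at countably
  many times; continuity extends them to the interval.\<close>

lemma le_on_Icc_from_Rats:
  fixes h :: "real \<Rightarrow> real"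
  assumes "0 < T" "continuous_on {0..T} h" "\<And>q. q \<in> {0..T} \<inter> \<rat> \<Longrightarrow> h q \<le> B" "t \<in> {0..T}"
  shows "h t \<le> B"
  using assms continuous_le_on_closure[of "{0..T} \<inter> \<rat>" h t B] by (simp add: closure_Rats_Icc)

text \<open>The set where \<open>Q\<close> holds need not be measurable, so the proof passes to a
  measurable null set containing the exceptions. This is how path continuity reaches the product
  space.\<close>

lemma (in pair_sigma_finite) AE_fst_snd:
  shows AE_fst: "AE x in M1. Q x \<Longrightarrow> AE z in M1 \<Otimes>\<^sub>M M2. Q (fst z)"
    and AE_snd: "AE y in M2. R y \<Longrightarrow> AE z in M1 \<Otimes>\<^sub>M M2. R (snd z)"
proof -
  assume "AE x in M1. Q x"
  then obtain N where N: "{x \<in> space M1. \<not> Q x} \<subseteq> N" "N \<in> null_sets M1" by (auto simp: eventually_ae_filter)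
  then have [measurable]: "N \<in> sets M1" by auto
  have "AE z in M1 \<Otimes>\<^sub>M M2. fst z \<notin> N"
    using AE_not_in[OF N(2)] by (intro AE_pair_measure) auto
  with AE_space show "AE z in M1 \<Otimes>\<^sub>M M2. Q (fst z)"
    by eventually_elim (use N in \<open>auto simp: space_pair_measure\<close>)
next
  assume "AE y in M2. R y"
  then obtain N where N: "{x \<in> space M2. \<not> R x} \<subseteq> N" "N \<in> null_sets M2" by (auto simp: eventually_ae_filter)
  then have [measurable]: "N \<in> sets M2" by auto
  have "AE z in M1 \<Otimes>\<^sub>M M2. snd z \<notin> N"
    using AE_not_in[OF N(2)] by (intro AE_pair_measure) auto
  with AE_space show "AE z in M1 \<Otimes>\<^sub>M M2. R (snd z)"
    by eventually_elim (use N in \<open>auto simp: space_pair_measure\<close>)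
qed

context standard_brownian_motion
begin

text \<open>Rational times make it measurable for arbitrary paths, and \<open>ennreal\<close> values
  make it meaningful for unbounded ones. For a continuous path and \<open>T > 0\<close> it is the
  maximum of \<open>|W|\<close> on \<open>{0..T}\<close>.\<close>

definition path_sup :: "real \<Rightarrow> 'a \<Rightarrow> ennreal" where
  "path_sup T \<omega> = (SUP q\<in>{0..T} \<inter> \<rat>. ennreal \<bar>W q \<omega>\<bar>)"

lemma measurable_path_sup[measurable]: "path_sup T \<in> borel_measurable M"
  unfolding path_sup_def[abs_def]
proof (rule borel_measurable_SUP)
  show "countable ({0..T} \<inter> \<rat>)" by (intro countable_Int2 countable_rat)
  show "(\<lambda>\<omega>. ennreal \<bar>W q \<omega>\<bar>) \<in> borel_measurable M" if "q \<in> {0..T} \<inter> \<rat>" for q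
    using that measurable_W[of q] by (intro measurable_compose[OF _ measurable_ennreal] borel_measurable_abs) auto
qed

lemma path_sup_bound:
  assumes "0 < T" and cont: "continuous_on {0..} (\<lambda>t. W t \<omega>)"
  shows "path_sup T \<omega> < \<infinity>" and "\<And>s. s \<in> {0..T} \<Longrightarrow> \<bar>W s \<omega>\<bar> \<le> enn2real (path_sup T \<omega>)"
proof -
  have c: "continuous_on {0..T} (\<lambda>t. W t \<omega>)" using cont by (rule continuous_on_subset) auto
  then have "bounded ((\<lambda>t. W t \<omega>) ` {0..T})" by (intro compact_imp_bounded compact_continuous_image) auto
  then obtain B where B: "\<And>t. t \<in> {0..T} \<Longrightarrow> \<bar>W t \<omega>\<bar> \<le> B" unfolding bounded_iff by fastforce
  have "path_sup T \<omega> \<le> ennreal B"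
    unfolding path_sup_def using B by (intro SUP_least ennreal_leI) auto
  then show fin: "path_sup T \<omega> < \<infinity>" using le_less_trans[of _ "ennreal B" \<infinity>] by simp
  fix s assume s: "s \<in> {0..T}"
  show "\<bar>W s \<omega>\<bar> \<le> enn2real (path_sup T \<omega>)"
  proof (rule le_on_Icc_from_Rats[OF \<open>0 < T\<close> _ _ s])
    show "continuous_on {0..T} (\<lambda>s. \<bar>W s \<omega>\<bar>)" using c by (rule continuous_on_rabs)
    fix q assume "q \<in> {0..T} \<inter> \<rat>"
    then have "ennreal \<bar>W q \<omega>\<bar> \<le> path_sup T \<omega>" unfolding path_sup_def by (rule SUP_upper)
    from enn2real_mono[OF this] fin show "\<bar>W q \<omega>\<bar> \<le> enn2real (path_sup T \<omega>)" by simp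
  qed
qed

end

lemma SUP_tendsto_0_from_Rats_bound:
  fixes h :: "nat \<Rightarrow> real \<Rightarrow> real"
  assumes T: "0 < T" and K: "K < \<infinity>" and D: "D \<longlonglongrightarrow> 0"
    and cont: "\<And>n. 1 \<le> n \<Longrightarrow> continuous_on {0..T} (h n)"
    and le: "\<And>n q. 1 \<le> n \<Longrightarrow> q \<in> {0..T} \<inter> \<rat> \<Longrightarrow> ennreal \<bar>h n q\<bar> \<le> K * D n"
  shows "(\<lambda>n. SUP t\<in>{0..T}. \<bar>h n t\<bar>) \<longlonglongrightarrow> 0"
proof -
  define B where "B n = enn2real (K * D n)" for n
  have "(\<lambda>n. K * D n) \<longlonglongrightarrow> K * 0"
    using K D by (intro ennreal_tendsto_cmult) auto
  then have KD: "(\<lambda>n. K * D n) \<longlonglongrightarrow> ennreal 0" by simp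
  then have B0: "B \<longlonglongrightarrow> 0" unfolding B_def by (rule tendsto_enn2real) simp
  \<comment> \<open>From some index on the bound is finite, so \<open>enn2real\<close> loses
    nothing; it would turn an infinite bound into 0.\<close>
  have "\<forall>\<^sub>F n in sequentially. K * D n < 1" using KD by (rule order_tendstoD) simp
  then have ev: "\<forall>\<^sub>F n in sequentially. 0 \<le> (SUP t\<in>{0..T}. \<bar>h n t\<bar>) \<and> (SUP t\<in>{0..T}. \<bar>h n t\<bar>) \<le> B n"
    using eventually_ge_at_top[of 1]
  proof eventually_elim
    case (elim n)
    have fin: "K * D n < \<infinity>" using elim(1) by (rule less_trans) simp
    have b: "\<bar>h n t\<bar> \<le> B n" if "t \<in> {0..T}" for t
    proof (rule le_on_Icc_from_Rats[OF T _ _ that])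
      show "continuous_on {0..T} (\<lambda>t. \<bar>h n t\<bar>)" using cont[OF elim(2)] by (rule continuous_on_rabs)
      show "\<bar>h n q\<bar> \<le> B n" if "q \<in> {0..T} \<inter> \<rat>" for q
        using enn2real_mono[OF le[OF elim(2) that]] fin by (simp add: B_def)
    qed
    have "\<bar>h n 0\<bar> \<le> (SUP t\<in>{0..T}. \<bar>h n t\<bar>)"
      using T b by (intro cSUP_upper bdd_aboveI2[of _ _ "B n"]) auto
    then have "0 \<le> (SUP t\<in>{0..T}. \<bar>h n t\<bar>)" by (rule order_trans[OF abs_ge_zero])
    moreover have "(SUP t\<in>{0..T}. \<bar>h n t\<bar>) \<le> B n"
      using T b by (intro cSUP_least) auto
    ultimately show ?case ..
  qed
  show ?thesis
    by (rule tendsto_sandwich[OF _ _ tendsto_const B0]) (use ev in \<open>auto elim: eventually_mono\<close>)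
qed

theorem theorem3p7:
  fixes \<rho> \<mu> lam T :: real
    and P :: "'a measure" and Pbar :: "'b measure"
    and \<alpha> :: "nat \<Rightarrow> 'b \<Rightarrow> real"
    and W :: "real \<Rightarrow> 'a \<Rightarrow> real"
    and Yn :: "nat \<Rightarrow> real \<Rightarrow> 'a \<times> 'b \<Rightarrow> real"
    and Y :: "real \<Rightarrow> 'a \<Rightarrow> real"
  assumes "1 < \<rho>" and "\<rho> \<le> 2" and "0 < \<mu>" and "0 < lam" and "0 < T"
    and "prob_space Pbar"
    and "prob_space.indep_vars Pbar (\<lambda>_. borel) \<alpha> {1..}"
    and "\<And>k. 1 \<le> k \<Longrightarrow> distributed Pbar lborel (\<alpha> k) (\<lambda>x. ennreal (gamma_density \<mu> lam x))"
    and "standard_brownian_motion P W"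
    and "\<And>n t. 1 \<le> n \<Longrightarrow> t \<in> {0..T} \<Longrightarrow> Yn n t \<in> borel_measurable (P \<Otimes>\<^sub>M Pbar)"
    and "\<And>n. 1 \<le> n \<Longrightarrow> AE \<eta> in Pbar. \<forall>t\<in>{0..T}. has_wiener_integral P W t
           (\<lambda>\<tau>. 1 / real n * (\<Sum>k=1..n. scalar_resolvent \<rho> (\<alpha> k \<eta>) (t - \<tau>)))
           (\<lambda>\<omega>. Yn n t (\<omega>, \<eta>))"
    and "\<And>n. 1 \<le> n \<Longrightarrow> AE x in P \<Otimes>\<^sub>M Pbar. continuous_on {0..T} (\<lambda>t. Yn n t x)"
    and "\<And>t. t \<in> {0..T} \<Longrightarrow> has_wiener_integral P W t
           (\<lambda>\<tau>. G_fun \<rho> \<mu> (- ((t - \<tau>) powr \<rho> / lam))) (Y t)"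
    and "AE \<omega> in P. continuous_on {0..T} (\<lambda>t. Y t \<omega>)"
  shows "AE (\<omega>, \<eta>) in P \<Otimes>\<^sub>M Pbar.
           (\<lambda>n. SUP t\<in>{0..T}. \<bar>Yn n t (\<omega>, \<eta>) - Y t \<omega>\<bar>) \<longlonglongrightarrow> 0"
proof -
  note \<rho> = assms(1) and T = assms(5) and D = assms(8) and Yn_meas = assms(10) and Yn_int = assms(11)
    and Yn_cont = assms(12) and Y_int = assms(13) and Y_cont = assms(14)
  interpret Q: prob_space Pbar by fact
  interpret BM: standard_brownian_motion P W by fact
  interpret PQ: pair_sigma_finite P Pbar ..
  \<comment> \<open>Any \<open>d > 0\<close> with \<open>2 * d < lam\<close> would do.\<close>
  define d where "d = lam / 4"
  have d: "0 < d" "2 * d < lam" using assms(4) by (auto simp: d_def)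
  obtain C where C: "0 \<le> C" "\<And>k. (T powr \<rho>) ^ k / Gamma (real k * \<rho> + 1) \<le> C * (d ^ k / fact k)"
    using inverse_Gamma_bound[of \<rho> "T powr \<rho>" d] \<rho> T d by auto
  define m where "m j = pochhammer \<mu> j / lam ^ j" for j
  define A where "A n \<eta> j = (\<Sum>k=1..n. \<alpha> k \<eta> ^ j) / real n" for n \<eta> j
  define E where "E n \<eta> = (\<Sum>j. ennreal (d ^ j / fact j * \<bar>A n \<eta> j - m j\<bar>))" for n \<eta>
  note conv = Q.gamma_empirical_moments_converge[OF assms(3,4,7) D d]
  have Elim: "AE \<eta> in Pbar. (\<lambda>n. E n \<eta>) \<longlonglongrightarrow> 0"
    using conv(1) unfolding E_def A_def m_def .
  have "0 \<le> m j" for j using assms(3,4) by (simp add: m_def pochhammer_nonneg)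
  then have ms: "summable (\<lambda>j. d ^ j / fact j * \<bar>m j\<bar>)"
    using conv(2)[folded m_def] by (simp only: abs_of_nonneg)
  have As: "summable (\<lambda>j. d ^ j / fact j * \<bar>A n \<eta> j\<bar>)" for n \<eta>
    unfolding A_def by (rule summable_average_powers[OF d(1)])
  have Es: "E n \<eta> = ennreal (\<Sum>j. d ^ j / fact j * \<bar>A n \<eta> j - m j\<bar>)" for n \<eta>
  proof -
    have "summable (\<lambda>j. d ^ j / fact j * \<bar>A n \<eta> j - m j\<bar>)"
    proof (rule summable_comparison_test'[OF summable_add[OF As ms], of 0])
      fix j
      have "d ^ j / fact j * \<bar>A n \<eta> j - m j\<bar> \<le> d ^ j / fact j * (\<bar>A n \<eta> j\<bar> + \<bar>m j\<bar>)"
        using d by (intro mult_left_mono) auto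
      then show "norm (d ^ j / fact j * \<bar>A n \<eta> j - m j\<bar>) \<le> d ^ j / fact j * \<bar>A n \<eta> j\<bar> + d ^ j / fact j * \<bar>m j\<bar>"
        using d by (simp add: abs_mult distrib_left)
    qed
    then show ?thesis unfolding E_def using d by (intro suminf_ennreal2) auto
  qed
  have \<alpha>_meas: "\<alpha> k \<in> borel_measurable Pbar" if "1 \<le> k" for k
    using distributed_measurable[OF D[OF that]] by simp
  have [measurable]: "(\<lambda>\<eta>. A n \<eta> j) \<in> borel_measurable Pbar" for n j
    unfolding A_def using \<alpha>_meas by (intro borel_measurable_divide borel_measurable_sum borel_measurable_power) auto
  have [measurable]: "E n \<in> borel_measurable Pbar" for n
    unfolding E_def[abs_def] by measurable
  let ?K = "BM.path_sup T"
  \<comment> \<open>The factor \<open>?K\<close> depends on \<open>\<omega>\<close> only and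
    \<open>E n\<close> on \<open>\<eta>\<close> only; their product is jointly measurable, which the
    exchange of almost everywhere quantifiers below requires.\<close>
  have bound: "AE x in P \<Otimes>\<^sub>M Pbar. ennreal \<bar>Yn n t x - Y t (fst x)\<bar> \<le> ennreal (3 * C) * ?K (fst x) * E n (snd x)"
    if n: "1 \<le> n" and t: "t \<in> {0..T}" for n t
  proof -
    let ?B = "\<lambda>x. ennreal \<bar>Yn n t x - Y t (fst x)\<bar> \<le> ennreal (3 * C) * ?K (fst x) * E n (snd x)"
    note [measurable] = Yn_meas[OF n t]
    have [measurable]: "Y t \<in> borel_measurable P" using Y_int[OF t] by (simp add: has_wiener_integral_def)
    have meas: "{x \<in> space (P \<Otimes>\<^sub>M Pbar). ?B x} \<in> sets (P \<Otimes>\<^sub>M Pbar)"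
      by measurable
    \<comment> \<open>With \<open>\<eta>\<close> fixed the coefficients \<open>A n \<eta>\<close>
      are numbers and the Wiener estimate applies under \<open>P\<close>. Its null set depends on
      \<open>\<eta>\<close>, so a Fubini argument, not an intersection of null sets, yields the
      product statement.\<close>
    have "AE \<eta> in Pbar. AE \<omega> in P. ?B (\<omega>, \<eta>)"
      using Yn_int[OF n]
    proof eventually_elim
      case (elim \<eta>)
      have "AE \<omega> in P. \<forall>K. (\<forall>s\<in>{0..t}. \<bar>W s \<omega>\<bar> \<le> K) \<longrightarrow>
          \<bar>Yn n t (\<omega>, \<eta>) - Y t \<omega>\<bar> \<le> 3 * K * (C * (\<Sum>k. d ^ k / fact k * \<bar>A n \<eta> k - m k\<bar>))"
      proof (rule BM.frac_series_wiener_bound[OF \<rho> d(1) As ms C(2) t bspec[OF elim t] Y_int[OF t]])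
        fix \<tau> assume "\<tau> \<in> {0..t}"
        then show "1 / real n * (\<Sum>k=1..n. scalar_resolvent \<rho> (\<alpha> k \<eta>) (t - \<tau>)) = frac_series \<rho> (A n \<eta>) (t - \<tau>)"
          using average_scalar_resolvent[OF \<rho>, of "t - \<tau>" n "\<lambda>k. \<alpha> k \<eta>"] by (simp add: A_def[abs_def])
        show "G_fun \<rho> \<mu> (- ((t - \<tau>) powr \<rho> / lam)) = frac_series \<rho> m (t - \<tau>)"
          by (simp add: G_fun_eq_frac_series m_def[abs_def])
      qed
      then show ?case
        using BM.continuous_paths
      proof eventually_elim
        case (elim \<omega>)
        note K = BM.path_sup_bound[OF T elim(2)]
        define S where "S = (\<Sum>k. d ^ k / fact k * \<bar>A n \<eta> k - m k\<bar>)"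
        define r where "r = enn2real (?K \<omega>)"
        have r: "0 \<le> r" "?K \<omega> = ennreal r" using K(1) by (auto simp: r_def)
        have "\<bar>Yn n t (\<omega>, \<eta>) - Y t \<omega>\<bar> \<le> 3 * r * (C * S)"
          using elim(1) K(2) t unfolding S_def r_def by auto
        also have "\<dots> = 3 * C * r * S" by simp
        finally have "ennreal \<bar>Yn n t (\<omega>, \<eta>) - Y t \<omega>\<bar> \<le> ennreal (3 * C * r * S)"
          by (rule ennreal_leI)
        also have "\<dots> = ennreal (3 * C) * ennreal r * ennreal S"
          using r(1) C(1) by (simp add: ennreal_mult')
        finally show ?case using r(2) Es[of n \<eta>] by (simp add: S_def)
      qed
    qed
    then have "AE \<omega> in P. AE \<eta> in Pbar. ?B (\<omega>, \<eta>)"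
      using PQ.AE_commute[of "\<lambda>\<omega> \<eta>. ?B (\<omega>, \<eta>)"] meas by simp
    then show ?thesis by (rule PQ.AE_pair_measure[OF meas])
  qed
  have cQ: "countable ({0..T} \<inter> \<rat>)" by (intro countable_Int2 countable_rat)
  \<comment> \<open>Countably many \<open>n\<close> and rational \<open>t\<close> share one null
    set.\<close>
  have bound': "AE x in P \<Otimes>\<^sub>M Pbar. \<forall>n\<in>{1..}. \<forall>t\<in>{0..T} \<inter> \<rat>.
      ennreal \<bar>Yn n t x - Y t (fst x)\<bar> \<le> ennreal (3 * C) * ?K (fst x) * E n (snd x)"
    using bound by (simp add: AE_ball_countable cQ)
  have cont': "AE x in P \<Otimes>\<^sub>M Pbar. \<forall>n\<in>{1..}. continuous_on {0..T} (\<lambda>t. Yn n t x)"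
    using Yn_cont by (simp add: AE_ball_countable)
  have "AE x in P \<Otimes>\<^sub>M Pbar. (\<lambda>n. SUP t\<in>{0..T}. \<bar>Yn n t x - Y t (fst x)\<bar>) \<longlonglongrightarrow> 0"
    using bound' cont' PQ.AE_fst[OF Y_cont] PQ.AE_fst[OF BM.continuous_paths] PQ.AE_snd[OF Elim]
  proof eventually_elim
    case (elim x)
    show ?case
    proof (rule SUP_tendsto_0_from_Rats_bound[OF T _ elim(5)])
      show "ennreal (3 * C) * ?K (fst x) < \<infinity>"
        using BM.path_sup_bound(1)[OF T elim(4)] by (simp add: ennreal_mult_less_top)
      show "continuous_on {0..T} (\<lambda>t. Yn n t x - Y t (fst x))" if "1 \<le> n" for n
        using elim(2,3) that by (intro continuous_on_diff) auto
      show "ennreal \<bar>Yn n q x - Y q (fst x)\<bar> \<le> ennreal (3 * C) * ?K (fst x) * E n (snd x)"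
        if "1 \<le> n" "q \<in> {0..T} \<inter> \<rat>" for n q
        using elim(1) that by auto
    qed
  qed
  then show ?thesis by (simp add: case_prod_beta')
qed

end
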